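(* Let $b$ and $P$ (with $R=I-P^t$) satisfy conditions (A1), (A2), (A3), (B1), (B2) of the context, and let $X:[0,\infty)\to\mathbb{R}^n$ be càdlàg with $X(0)\in[0,\infty)^n$. For $1\le i\le n$ put $\beta_i(s)=\sup\{b_i(s,0,w):w\in[0,\infty)^n\}$, $s\ge 0$. (i) Suppose that for each $1\le i\le n$ $$\liminf_{t\to\infty}\Bigl[X_i(t)+\int_0^t\beta_i(s)\,ds\Bigr]=-\infty. \qquad (\ast)$$ Then for any $a\in[0,\infty)^n$ there is $T\ge 0$ such that $W^a(t)=W^0(t)$ for all $t\ge T$. In particular $\lim_{t\to\infty}[W^a(t)-W^0(t)]=0$ for any $a\in[0,\infty)^n$. (ii) Suppose in addition to (A1)–(A3), (B1), (B2) that $R$ is a constant matrix, and put $\hat\beta_i(s)=\sup\{(R^{-1}b)_i(s,0,w):w\in[0,\infty)^n\}$, $s\ge 0$. Suppose that for each $1\le i\le n$ at least one among $(\ast)$ and $$\liminf_{t\to\infty}\Bigl[(R^{-1}X)_i(t)+\int_0^t\hat\beta_i(s)\,ds\Bigr]=-\infty$$ holds. Then the conclusions of part (i) remain valid.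
   Context: Let $(t,\ell,w)\mapsto b(t,\ell,w)\in\mathbb{R}^n$ and $(t,\ell,w)\mapsto P(t,\ell,w)\in\mathbb{R}^{n\times n}$ be functions of $t\in[0,\infty)$, $\ell\in[0,\infty)^n$, $w\in[0,\infty)^n$, with coordinates $b_i$ and $p_{ij}$, and let $R=(R_{ij})=I-P^t$ ($^t$ applied to a matrix is transposition). For a vector $x=(x_1,\ldots,x_n)^t$ write $x_{[k]}=(x_1,\ldots,x_k)^t$. Conditions: (A1) $b,P$ are bounded, continuous, and Lipschitz continuous in $(\ell,w)$ coordinate-wise uniformly in $t$; $p_{ij}\ge 0$ and $p_{ii}\equiv 0$. (A2) With $\pi_{ij}=\sup_{t,\ell,w}p_{ij}(t,\ell,w)$, the matrix $\Pi=(\pi_{ij})$ has spectral radius strictly less than 1. (A3) All entries of $b$ and $R$ are nonincreasing in (each coordinate of) $\ell$ and nondecreasing in (each coordinate of) $w$. (B1) (feedforward structure) For each $1\le i\le n$: $R_{ij}\equiv 0$ if $j>i$; $R_{ii}\equiv 1$; $R_{ij}(s,\ell,w)=R_{ij}(s,\ell_{[i]},w_{[i]})$ if $j<i$; and $b_i(s,\ell,w)=b_i(s,\ell_{[i]},w_{[i]})$, for all $s\ge 0$, $\ell,w\ge 0$ (that is, these functions depend on $\ell,w$ only through their first $i$ coordinates). (B2) $b,R$ are independent of the variable $\ell$. For a càdlàg $Y:[0,\infty)\to\mathbb{R}^n$ with $Y(0)\in[0,\infty)^n$, the solution pair of the Skorohod problem in $[0,\infty)^n$ is the (under (A1), (A2)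 existing and unique) pair $(W(Y),L(Y))$ of $\mathbb{R}^n$-valued functions with $$W(Y)(t)=Y(t)+\int_0^t b\bigl(u,L(Y)(u-),W(Y)(u-)\bigr)du+\int_{[0,t]}R\bigl(u,L(Y)(u-),W(Y)(u-)\bigr)\,dL(Y)(u),\quad t\ge 0,$$ and, for each $i$: $L_i(Y)$ is nondecreasing, nonnegative and right continuous; $W_i(Y)\ge 0$; and $\int_{[0,\infty)}1_{\{W_i(Y)(t)>0\}}dL_i(Y)(t)=0$. Here $L(Y)(0)=0$. For $a\in[0,\infty)^n$ write $W^a=W(a+X)$, $L^a=L(a+X)$, where $(a+X)(t)=a+X(t)$; in particular $W^0=W(X)$, $L^0=L(X)$. *)

theory Defs
  imports "HOL-Analysis.Analysis"
begin

text \<open>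
  Vectors are of type \<open>real ^ 'n\<close> with \<open>'n\<close> a finite linearly ordered index type, so that \<open>k \<le> i\<close>
  selects the first coordinates up to \<open>i\<close>.  The order on \<open>real ^ 'n\<close> is the componentwise one;
  hence the set \<open>{0..}\<close> of vectors is the nonnegative orthant.
  Functions of time are total on \<open>real\<close>, but only their values on \<open>[0,\<infinity>)\<close> are ever used; likewise
  the coefficients are only used for \<open>t \<ge> 0\<close> and \<open>l, w\<close> in the orthant.
\<close>

definition coeff_dom :: "(real \<times> (real ^ 'n) \<times> (real ^ 'n)) set" where
  "coeff_dom = {0..} \<times> {0..} \<times> {0..}"

definition reflection ::
  "(real \<Rightarrow> real ^ 'n \<Rightarrow> real ^ 'n \<Rightarrow> real ^ 'n ^ 'n) \<Rightarrow> real \<Rightarrow> real ^ 'n \<Rightarrow> real ^ 'n \<Rightarrow> real ^ 'n ^ 'n"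
where
  "reflection P t l w = mat 1 - transpose (P t l w)"

definition spec_radius :: "real ^ 'n ^ 'n \<Rightarrow> real" where
  "spec_radius A = Max (norm ` {z :: complex. \<exists>v. v \<noteq> 0 \<and> map_matrix complex_of_real A *v v = z *s v})"

definition cond_A1 ::
  "(real \<Rightarrow> real ^ 'n \<Rightarrow> real ^ 'n \<Rightarrow> real ^ 'n) \<Rightarrow> (real \<Rightarrow> real ^ 'n \<Rightarrow> real ^ 'n \<Rightarrow> real ^ 'n ^ 'n) \<Rightarrow> bool"
where
  "cond_A1 b P \<longleftrightarrow>
     bounded ((\<lambda>(t, l, w). b t l w) ` coeff_dom) \<and>
     bounded ((\<lambda>(t, l, w). P t l w) ` coeff_dom) \<and>
     continuous_on coeff_dom (\<lambda>(t, l, w). b t l w) \<and>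
     continuous_on coeff_dom (\<lambda>(t, l, w). P t l w) \<and>
     (\<forall>i. \<exists>C. \<forall>t\<ge>0. C-lipschitz_on ({0..} \<times> {0..}) (\<lambda>(l, w). b t l w $ i)) \<and>
     (\<forall>i j. \<exists>C. \<forall>t\<ge>0. C-lipschitz_on ({0..} \<times> {0..}) (\<lambda>(l, w). P t l w $ i $ j)) \<and>
     (\<forall>t\<ge>0. \<forall>l\<ge>0. \<forall>w\<ge>0. \<forall>i j. P t l w $ i $ j \<ge> 0) \<and>
     (\<forall>t\<ge>0. \<forall>l\<ge>0. \<forall>w\<ge>0. \<forall>i. P t l w $ i $ i = 0)"

definition sup_matrix :: "(real \<Rightarrow> real ^ 'n \<Rightarrow> real ^ 'n \<Rightarrow> real ^ 'n ^ 'n) \<Rightarrow> real ^ 'n ^ 'n" where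
  "sup_matrix P = (\<chi> i j. SUP (t, l, w) \<in> coeff_dom. P t l w $ i $ j)"

definition cond_A2 :: "(real \<Rightarrow> real ^ 'n \<Rightarrow> real ^ 'n \<Rightarrow> real ^ 'n ^ 'n) \<Rightarrow> bool" where
  "cond_A2 P \<longleftrightarrow> spec_radius (sup_matrix P) < 1"

definition cond_A3 ::
  "(real \<Rightarrow> real ^ 'n \<Rightarrow> real ^ 'n \<Rightarrow> real ^ 'n) \<Rightarrow> (real \<Rightarrow> real ^ 'n \<Rightarrow> real ^ 'n \<Rightarrow> real ^ 'n ^ 'n) \<Rightarrow> bool"
where
  "cond_A3 b R \<longleftrightarrow>
     (\<forall>t\<ge>0. \<forall>w\<ge>0. \<forall>i. antimono_on {0..} (\<lambda>l. b t l w $ i)) \<and>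
     (\<forall>t\<ge>0. \<forall>w\<ge>0. \<forall>i j. antimono_on {0..} (\<lambda>l. R t l w $ i $ j)) \<and>
     (\<forall>t\<ge>0. \<forall>l\<ge>0. \<forall>i. mono_on {0..} (\<lambda>w. b t l w $ i)) \<and>
     (\<forall>t\<ge>0. \<forall>l\<ge>0. \<forall>i j. mono_on {0..} (\<lambda>w. R t l w $ i $ j))"

definition agree_upto :: "'n::{finite,linorder} \<Rightarrow> real ^ 'n::{finite,linorder} \<Rightarrow> real ^ 'n::{finite,linorder} \<Rightarrow> bool" where
  "agree_upto i x y \<longleftrightarrow> (\<forall>k\<le>i. x $ k = y $ k)"

definition cond_B1 ::
  "(real \<Rightarrow> real ^ 'n::{finite,linorder} \<Rightarrow> real ^ 'n::{finite,linorder} \<Rightarrow> real ^ 'n::{finite,linorder}) \<Rightarrow>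
   (real \<Rightarrow> real ^ 'n::{finite,linorder} \<Rightarrow> real ^ 'n::{finite,linorder} \<Rightarrow>
     real ^ 'n::{finite,linorder} ^ 'n::{finite,linorder}) \<Rightarrow> bool"
where
  "cond_B1 b R \<longleftrightarrow> (\<forall>i.
     (\<forall>j>i. \<forall>s\<ge>0. \<forall>l\<ge>0. \<forall>w\<ge>0. R s l w $ i $ j = 0) \<and>
     (\<forall>s\<ge>0. \<forall>l\<ge>0. \<forall>w\<ge>0. R s l w $ i $ i = 1) \<and>
     (\<forall>j<i. \<forall>s\<ge>0. \<forall>l\<ge>0. \<forall>w\<ge>0. \<forall>l'\<ge>0. \<forall>w'\<ge>0.
        agree_upto i l l' \<longrightarrow> agree_upto i w w' \<longrightarrow> R s l w $ i $ j = R s l' w' $ i $ j) \<and>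
     (\<forall>s\<ge>0. \<forall>l\<ge>0. \<forall>w\<ge>0. \<forall>l'\<ge>0. \<forall>w'\<ge>0.
        agree_upto i l l' \<longrightarrow> agree_upto i w w' \<longrightarrow> b s l w $ i = b s l' w' $ i))"

definition cond_B2 ::
  "(real \<Rightarrow> real ^ 'n \<Rightarrow> real ^ 'n \<Rightarrow> real ^ 'n) \<Rightarrow> (real \<Rightarrow> real ^ 'n \<Rightarrow> real ^ 'n \<Rightarrow> real ^ 'n ^ 'n) \<Rightarrow> bool"
where
  "cond_B2 b R \<longleftrightarrow>
     (\<forall>t\<ge>0. \<forall>l\<ge>0. \<forall>l'\<ge>0. \<forall>w\<ge>0. b t l w = b t l' w \<and> R t l w = R t l' w)"

definition cadlag :: "(real \<Rightarrow> 'a::topological_space) \<Rightarrow> bool" where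
  "cadlag f \<longleftrightarrow>
     (\<forall>t\<ge>0. continuous (at_right t) f) \<and> (\<forall>t>0. \<exists>y. (f \<longlongrightarrow> y) (at_left t))"

text \<open>
  \<open>f(u-)\<close>.  The value at \<open>u = 0\<close> is immaterial: in the equation below neither \<open>du\<close> nor \<open>dL\<close>
  charges the point \<open>0\<close>.
\<close>

definition left_lim :: "(real \<Rightarrow> 'a::t2_space) \<Rightarrow> real \<Rightarrow> 'a" where
  "left_lim f u = (if u \<le> 0 then f 0 else Lim (at_left u) f)"

text \<open>
  The measure \<open>dg\<close> of a nondecreasing, right continuous, nonnegative \<open>g\<close> on \<open>[0,\<infinity>)\<close>, with
  \<open>g(0-) = 0\<close>; thus it gives mass \<open>g 0\<close> to the point \<open>0\<close> and mass \<open>g t\<close> to \<open>[0,t]\<close>.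
\<close>

definition stieltjes :: "(real \<Rightarrow> real) \<Rightarrow> real measure" where
  "stieltjes g = interval_measure (\<lambda>t. if t < 0 then 0 else g t)"

text \<open>
  \<open>(W, L)\<close> is a solution pair of the Skorohod problem for \<open>Y\<close>.  That \<open>W\<close> is cadlag is what
  gives a meaning to \<open>W(u-)\<close> in the equation.  The complementarity condition is stated with the
  nonnegative integral because the Bochner integral is \<open>0\<close> also when the true value is \<open>\<infinity>\<close>.
\<close>

definition skorohod_solution ::
  "(real \<Rightarrow> real ^ 'n \<Rightarrow> real ^ 'n \<Rightarrow> real ^ 'n) \<Rightarrow> (real \<Rightarrow> real ^ 'n \<Rightarrow> real ^ 'n \<Rightarrow> real ^ 'n ^ 'n) \<Rightarrow>
   (real \<Rightarrow> real ^ 'n) \<Rightarrow> (real \<Rightarrow> real ^ 'n) \<Rightarrow> (real \<Rightarrow> real ^ 'n) \<Rightarrow> bool"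
where
  "skorohod_solution b R Y W L \<longleftrightarrow>
     cadlag W \<and>
     L 0 = 0 \<and>
     (\<forall>i. mono_on {0..} (\<lambda>t. L t $ i) \<and>
          (\<forall>t\<ge>0. 0 \<le> L t $ i) \<and>
          (\<forall>t\<ge>0. continuous (at_right t) (\<lambda>t. L t $ i)) \<and>
          (\<forall>t\<ge>0. 0 \<le> W t $ i) \<and>
          (\<integral>\<^sup>+ t \<in> {0..}. indicator {t. W t $ i > 0} t \<partial>stieltjes (\<lambda>t. L t $ i)) = 0) \<and>
     (\<forall>t\<ge>0. \<forall>i.
        W t $ i = Y t $ i
          + (LBINT u:{0..t}. b u (left_lim L u) (left_lim W u) $ i)
          + (\<Sum>j\<in>UNIV. LINT u:{0..t}|stieltjes (\<lambda>t. L t $ j).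
               R u (left_lim L u) (left_lim W u) $ i $ j))"

definition sup_drift :: "(real \<Rightarrow> real ^ 'n \<Rightarrow> real ^ 'n \<Rightarrow> real ^ 'n) \<Rightarrow> 'n \<Rightarrow> real \<Rightarrow> real" where
  "sup_drift b i s = (SUP w\<in>{0..}. b s 0 w $ i)"

definition liminf_cond ::
  "(real \<Rightarrow> real ^ 'n) \<Rightarrow> (real \<Rightarrow> real ^ 'n \<Rightarrow> real ^ 'n \<Rightarrow> real ^ 'n) \<Rightarrow> 'n \<Rightarrow> bool"
where
  "liminf_cond X b i \<longleftrightarrow>
     Liminf at_top (\<lambda>t. ereal (X t $ i + (LBINT s:{0..t}. sup_drift b i s))) = -\<infinity>"

end

theory Submission
  imports Defs
begin

text \<open>
  Both parts have the same reason: two solutions driven by \<open>X\<close> and by a translate \<open>a + X\<close> merge one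
  coordinate after the other. Suppose that the coordinates below \<open>i\<close> have merged by a time \<open>T\<close>. By the
  feedforward structure, after \<open>T\<close> the \<open>i\<close>-th equations of the two solutions differ only through the
  \<open>i\<close>-th coordinate itself. Therefore its order is preserved (\<open>order_preserved\<close>), and two solutions that
  meet in coordinate \<open>i\<close> stay together (\<open>stay_together\<close>). If the regulator \<open>L $ i\<close> of the larger solution
  is unbounded, then this solution is at \<open>0\<close> at some time after \<open>T\<close> (\<open>hits_boundary\<close>); the smaller one,
  which is nonnegative, has to be at \<open>0\<close> at the same time, and this is where they meet
  (\<open>eventually_equal_coordinate\<close>). A comparison of the two solutions before \<open>T\<close> is avoided: it does not
  matter which of them is ahead.

  Order preservation is the delicate step, since the regulators of lower coordinates may jump.
  Let \<open>D\<close> be the difference of the \<open>i\<close>-th coordinates. By monotonicity of the coefficients in \<open>w\<close>, the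
  drift and the lower regulators cannot drive \<open>D\<close> down as long as \<open>D \<ge> 0\<close>, not even by a jump; by the
  Lipschitz condition they do so at most at a rate proportional to \<open>m\<close> as long as \<open>D \<ge> -m\<close>. The \<open>i\<close>-th
  regulator of the subtracted solution also drives \<open>D\<close> down, but it grows only when that solution is
  at \<open>0\<close>, and then \<open>D \<ge> 0\<close>. A contraction argument on short intervals (\<open>nonneg_of_local_self_bound\<close>)
  concludes from this that \<open>D\<close> never becomes negative.

  It remains to see that all \<open>L $ i\<close> are unbounded. Under the first \<open>liminf\<close> condition, \<open>W $ i\<close> is bounded
  above by a constant plus \<open>X $ i\<close> plus the integral of the largest possible drift plus \<open>L $ i\<close>
  (\<open>unbounded_regulator\<close>). Under the second one the same argument is applied to the equation multiplied
  by the inverse of \<open>R\<close>, a matrix with nonnegative entries (\<open>unbounded_regulator_constant_reflection\<close>).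
\<close>

section \<open>Stieltjes measures of regulators\<close>

text \<open>
  The properties that a coordinate of \<open>L\<close> has in a solution pair. They make the distribution
  function behind \<open>stieltjes g\<close> monotone and right continuous on the whole line.
\<close>
definition regulator :: "(real \<Rightarrow> real) \<Rightarrow> bool" where
  "regulator g \<longleftrightarrow> mono_on {0..} g \<and> (\<forall>t\<ge>0. continuous (at_right t) g) \<and> g 0 = 0"

lemma regulator_mono: "regulator g \<Longrightarrow> 0 \<le> r \<Longrightarrow> r \<le> t \<Longrightarrow> g r \<le> g t"
  unfolding regulator_def mono_on_def by auto

lemma sets_stieltjes [simp, measurable_cong]: "sets (stieltjes g) = sets borel"
  and space_stieltjes [simp]: "space (stieltjes g) = UNIV"
  unfolding stieltjes_def by simp_all

lemma emeasure_stieltjes_Ioc_real: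
  assumes g: "regulator g" and "a \<le> b"
  shows "emeasure (stieltjes g) {a<..b} = ennreal ((if b < 0 then 0 else g b) - (if a < 0 then 0 else g a))"
proof -
  let ?F = "\<lambda>t. if t < 0 then 0 else g t"
  have mono: "?F x \<le> ?F y" if "x \<le> y" for x y
    using regulator_mono[OF g, of x y] regulator_mono[OF g, of 0 y] g that
    by (auto simp: regulator_def)
  have cont: "continuous (at_right a) ?F" for a
  proof (cases "a < 0")
    case True
    have "eventually (\<lambda>x. ?F x = 0) (at_right a)"
      using eventually_at_right_real[OF True] by eventually_elim auto
    then show ?thesis
      using True by (simp add: continuous_within tendsto_eventually)
  next
    case False
    then have *: "(g \<longlongrightarrow> g a) (at_right a)"
      using g by (auto simp: regulator_def continuous_within)
    have "eventually (\<lambda>x. g x = ?F x) (at_right a)"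
      using eventually_at_right_less[of a] by eventually_elim (use False in auto)
    with * have "(?F \<longlongrightarrow> g a) (at_right a)"
      by (rule Lim_transform_eventually)
    then show ?thesis using False by (simp add: continuous_within)
  qed
  show ?thesis
    unfolding stieltjes_def by (rule emeasure_interval_measure_Ioc[OF \<open>a \<le> b\<close> mono cont])
qed

lemma emeasure_stieltjes_Ioc:
  assumes "regulator g" and "0 \<le> r" "r \<le> t"
  shows "emeasure (stieltjes g) {r<..t} = ennreal (g t - g r)"
  using emeasure_stieltjes_Ioc_real[OF assms(1,3)] assms by simp

lemma measure_stieltjes_Ioc:
  assumes "regulator g" and "0 \<le> r" "r \<le> t"
  shows "measure (stieltjes g) {r<..t} = g t - g r"
  using emeasure_stieltjes_Ioc[OF assms] regulator_mono[OF assms] by (simp add: measure_def)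

lemma emeasure_stieltjes_finite:
  assumes "regulator g" and "0 \<le> t"
  shows "emeasure (stieltjes g) {0..t} < \<infinity>"
proof -
  have "emeasure (stieltjes g) {0..t} \<le> emeasure (stieltjes g) {-1<..t}"
    by (rule emeasure_mono) auto
  also have "\<dots> < \<infinity>"
    using assms by (subst emeasure_stieltjes_Ioc_real) auto
  finally show ?thesis .
qed

text \<open>
  A null interval \<open>[s,t]\<close> contains its left end point, so \<open>g\<close> has no jump at \<open>s\<close>: the increments of \<open>g\<close>
  over \<open>(r,t]\<close> tend to \<open>0\<close> as \<open>r\<close> increases to \<open>s\<close>, by continuity of the measure from above.
\<close>
lemma stieltjes_Icc_null_imp_small_increment:
  assumes g: "regulator g" and "0 < s" "s \<le> t"
    and null: "emeasure (stieltjes g) {s..t} = 0" and "0 < \<eta>"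
  shows "\<exists>r0\<ge>0. r0 < s \<and> (\<forall>r. r0 \<le> r \<longrightarrow> r < s \<longrightarrow> g t - g r < \<eta>)"
proof -
  define x where "x n = s - s / real (Suc n)" for n
  have x: "0 \<le> x n" "x n < s" for n
    using \<open>0 < s\<close> by (auto simp: x_def field_simps)
  have inc: "x m \<le> x n" if "m \<le> n" for m n
    using that \<open>0 < s\<close> by (auto simp: x_def intro!: divide_left_mono)
  have lim: "x \<longlonglongrightarrow> s"
  proof -
    have "(\<lambda>n. s - s * (1 / real (Suc n))) \<longlonglongrightarrow> s - s * 0"
      by (intro tendsto_intros LIMSEQ_Suc[OF lim_1_over_n])
    then show ?thesis by (simp add: x_def[abs_def])
  qed
  have em: "emeasure (stieltjes g) {x n<..t} = ennreal (g t - g (x n))" for n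
    by (rule emeasure_stieltjes_Ioc[OF g]) (use x[of n] \<open>s \<le> t\<close> in auto)
  have "(\<lambda>n. emeasure (stieltjes g) {x n<..t}) \<longlonglongrightarrow> emeasure (stieltjes g) (\<Inter>n. {x n<..t})"
    by (rule Lim_emeasure_decseq) (use inc in \<open>force simp: em decseq_def\<close>)+
  also have "(\<Inter>n. {x n<..t}) = {s..t}"
  proof safe
    fix u assume u: "u \<in> (\<Inter>n. {x n<..t})"
    then have "\<forall>n. x n \<le> u" by (auto intro: less_imp_le)
    then have "s \<le> u" using LIMSEQ_le_const2[OF lim] by blast
    with u show "u \<in> {s..t}" by auto
  next
    fix u n assume "u \<in> {s..t}"
    then show "u \<in> {x n<..t}" using x[of n] by auto
  qed
  finally have "(\<lambda>n. ennreal (g t - g (x n))) \<longlonglongrightarrow> ennreal 0"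
    by (simp add: em null)
  moreover have "x n \<le> t" for n
    using x(2)[of n] \<open>s \<le> t\<close> by simp
  ultimately have "(\<lambda>n. g t - g (x n)) \<longlonglongrightarrow> 0"
    by (subst (asm) tendsto_ennreal_iff)
       (use x in \<open>auto intro!: always_eventually regulator_mono[OF g]\<close>)
  then have "eventually (\<lambda>n. g t - g (x n) < \<eta>) sequentially"
    using \<open>0 < \<eta>\<close> by (rule order_tendstoD)
  then obtain n where n: "g t - g (x n) < \<eta>"
    by (auto simp: eventually_sequentially)
  show ?thesis
  proof (intro exI[of _ "x n"] conjI allI impI)
    fix r assume "x n \<le> r" "r < s"
    then have "g (x n) \<le> g r" by (intro regulator_mono[OF g] x)
    then show "g t - g r < \<eta>" using n by linarith
  qed (use x in auto)
qed

text \<open>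
  If \<open>g\<close> does not charge the set where \<open>D < 0\<close>, then a negative value of \<open>D\<close> can be traced back to a
  nonnegative one with hardly any increment of \<open>g\<close> in between. The time \<open>r\<close> is the supremum \<open>\<sigma>\<close> of the
  times before \<open>t\<close> with \<open>D \<ge> 0\<close> if \<open>\<sigma>\<close> is itself such a time. Otherwise \<open>D\<close> has jumped at \<open>\<sigma>\<close>, the
  point \<open>\<sigma>\<close> is not charged either, and \<open>r\<close> is taken just before it; this is the reason for \<open>\<eta>\<close>.
\<close>
lemma last_nonneg_time_before_flat_stretch:
  assumes g: "regulator g" and st: "0 \<le> s" "s \<le> t"
    and flat: "\<And>S. S \<in> sets borel \<Longrightarrow> S \<subseteq> {0..} \<Longrightarrow> (\<And>u. u \<in> S \<Longrightarrow> D u < 0) \<Longrightarrow>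
                 emeasure (stieltjes g) S = 0"
    and D: "(0::real) \<le> D s" "D t < 0" and "0 < \<eta>"
  shows "\<exists>r. s \<le> r \<and> r < t \<and> 0 \<le> D r \<and> g t - g r < \<eta>"
proof -
  define A where "A = {u. s \<le> u \<and> u \<le> t \<and> 0 \<le> D u}"
  define \<sigma> where "\<sigma> = Sup A"
  have bdd: "bdd_above A" unfolding A_def by (rule bdd_aboveI[of _ t]) auto
  have sA: "s \<in> A" using st D by (auto simp: A_def)
  have le: "s \<le> \<sigma>" unfolding \<sigma>_def by (rule cSup_upper[OF sA bdd])
  have le': "\<sigma> \<le> t" unfolding \<sigma>_def by (rule cSup_least) (use sA in \<open>auto simp: A_def\<close>)
  have neg: "D u < 0" if "\<sigma> < u" "u \<le> t" for u
  proof (rule ccontr)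
    assume "\<not> D u < 0"
    then have "u \<in> A" using that le by (auto simp: A_def)
    then have "u \<le> \<sigma>" unfolding \<sigma>_def by (rule cSup_upper[OF _ bdd])
    with that show False by simp
  qed
  show ?thesis
  proof (cases "0 \<le> D \<sigma>")
    case True
    then have "\<sigma> < t" using le' D by (cases "\<sigma> = t") auto
    have "emeasure (stieltjes g) {\<sigma><..t} = 0"
      by (rule flat) (use neg le st in auto)
    then have "g t - g \<sigma> \<le> 0"
      using emeasure_stieltjes_Ioc[OF g, of \<sigma> t] le le' st by (auto simp: ennreal_eq_0_iff)
    then show ?thesis using True \<open>\<sigma> < t\<close> le \<open>0 < \<eta>\<close> by (intro exI[of _ \<sigma>]) auto
  next
    case False
    have pos: "0 < \<sigma>" using False D le st by (cases "s = \<sigma>") auto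
    have "emeasure (stieltjes g) {\<sigma>..t} = 0"
    proof (rule flat)
      fix u assume "u \<in> {\<sigma>..t}"
      then show "D u < 0" using neg[of u] False by (cases "u = \<sigma>") auto
    qed (use pos in auto)
    then obtain r0 where r0: "r0 < \<sigma>" "\<And>r. r0 \<le> r \<Longrightarrow> r < \<sigma> \<Longrightarrow> g t - g r < \<eta>"
      using stieltjes_Icc_null_imp_small_increment[OF g pos le' _ \<open>0 < \<eta>\<close>] by blast
    obtain r where r: "r \<in> A" "r0 < r"
      using less_cSupD[of A r0] r0(1) sA unfolding \<sigma>_def by auto
    have "r \<le> \<sigma>" unfolding \<sigma>_def by (rule cSup_upper[OF r(1) bdd])
    moreover have "r \<noteq> \<sigma>" using r False by (auto simp: A_def)
    ultimately show ?thesis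
      using r r0(2)[of r] le' by (intro exI[of _ r]) (auto simp: A_def)
  qed
qed

text \<open>
  Restricted to \<open>(r,t]\<close>, the measures \<open>dg\<close> and \<open>dh\<close> coincide, as both give the same mass to each
  half-line. This allows the two integrals in a difference of Skorohod equations to be taken with
  respect to one measure.
\<close>
lemma stieltjes_set_integral_cong_increments:
  assumes g: "regulator g" and h: "regulator h" and "0 \<le> r" "r \<le> t"
    and incr: "\<And>u. r \<le> u \<Longrightarrow> u \<le> t \<Longrightarrow> g u - h u = c"
    and f: "set_integrable (stieltjes g) {r<..t} f"
  shows "(LINT u:{r<..t}|stieltjes g. (f u :: real)) = (LINT u:{r<..t}|stieltjes h. f u)"
proof -
  let ?I = "indicator {r<..t} :: real \<Rightarrow> real"
  let ?f = "\<lambda>u. ?I u *\<^sub>R f u"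
  have meas: "?f \<in> borel_measurable borel"
    using borel_measurable_integrable[OF f[unfolded set_integrable_def]] by simp
  have dens: "emeasure (density (stieltjes k) ?I) {x<..} = ennreal (k t - k (max r (min x t)))"
    if k: "regulator k" for k x
  proof -
    have "emeasure (density (stieltjes k) ?I) {x<..} = emeasure (stieltjes k) ({r<..t} \<inter> {x<..})"
      using emeasure_restricted[of "{r<..t}" "stieltjes k" "{x<..}"]
      by (simp add: ennreal_indicator)
    also have "{r<..t} \<inter> {x<..} = {max r (min x t)<..t}" using \<open>r \<le> t\<close> by auto
    also have "emeasure (stieltjes k) \<dots> = ennreal (k t - k (max r (min x t)))"
      by (rule emeasure_stieltjes_Ioc[OF k]) (use assms in auto)
    finally show ?thesis .
  qed
  have eq: "density (stieltjes g) ?I = density (stieltjes h) ?I"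
  proof (rule measure_eqI_lessThan)
    fix x
    have "g t - g (max r (min x t)) = h t - h (max r (min x t))"
      using incr[of t] incr[of "max r (min x t)"] \<open>r \<le> t\<close> by (smt (verit) max_def min_def)
    then show "emeasure (density (stieltjes g) ?I) {x<..} = emeasure (density (stieltjes h) ?I) {x<..}"
      by (simp add: dens g h)
  qed (auto simp: dens g h)
  have *: "(LINT u:{r<..t}|stieltjes k. f u) = integral\<^sup>L (density (stieltjes k) ?I) ?f" for k
    unfolding set_lebesgue_integral_def
    by (subst integral_density) (use meas in \<open>auto intro!: Bochner_Integration.integral_cong split: split_indicator\<close>)
  show ?thesis unfolding * eq ..
qed

section \<open>A comparison principle on the line\<close>

text \<open>
  A substitute for Gronwall's inequality with respect to a measure that may have atoms. Let \<open>s\<close> be the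
  infimum of the times with \<open>D < 0\<close>. The bound with \<open>m = 0\<close> forbids a jump into the negative at \<open>s\<close>, and
  right continuity of \<open>K\<close> makes the bound contracting on a short interval \<open>[s,e)\<close>, so that its iteration
  gives \<open>D \<ge> 0\<close> there, against the choice of \<open>s\<close>.
\<close>
lemma nonneg_of_local_self_bound:
  fixes D K :: "real \<Rightarrow> real"
  assumes D: "\<And>s. T \<le> s \<Longrightarrow> continuous (at_right s) D"
    and K: "\<And>s. T \<le> s \<Longrightarrow> continuous (at_right s) K"
    and start: "0 \<le> D T"
    and bound: "\<And>s t m. T \<le> s \<Longrightarrow> s \<le> t \<Longrightarrow> 0 \<le> D s \<Longrightarrow> 0 \<le> m \<Longrightarrow>
                  (\<And>u. s \<le> u \<Longrightarrow> u < t \<Longrightarrow> - m \<le> D u) \<Longrightarrow> - (m * (K t - K s)) \<le> D t"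
    and "T \<le> t"
  shows "0 \<le> D t"
proof (rule ccontr)
  assume neg: "\<not> 0 \<le> D t"
  define B where "B = {u. T \<le> u \<and> D u < 0}"
  define s where "s = Inf B"
  have bdd: "bdd_below B" unfolding B_def by (rule bdd_belowI[of _ T]) auto
  have "t \<in> B" using neg \<open>T \<le> t\<close> by (auto simp: B_def)
  have Ts: "T \<le> s" unfolding s_def by (rule cInf_greatest) (use \<open>t \<in> B\<close> in \<open>auto simp: B_def\<close>)
  have before: "0 \<le> D u" if "T \<le> u" "u < s" for u
  proof (rule ccontr)
    assume "\<not> 0 \<le> D u"
    then have "s \<le> u" unfolding s_def by (intro cInf_lower bdd) (use that in \<open>auto simp: B_def\<close>)
    with that show False by simp
  qed
  have Ds: "0 \<le> D s"
    using bound[of T s 0] Ts start before by auto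
  have "eventually (\<lambda>u. - 1 < D u) (at_right s)"
    using D[OF Ts] Ds by (intro order_tendstoD(1)[of D "D s"]) (auto simp: continuous_within)
  moreover have "eventually (\<lambda>u. K u < K s + 1/2) (at_right s)"
    using K[OF Ts] by (intro order_tendstoD(2)[of K "K s"]) (auto simp: continuous_within)
  ultimately have "eventually (\<lambda>u. - 1 < D u \<and> K u < K s + 1/2) (at_right s)"
    by eventually_elim simp
  then obtain e where e: "s < e" "\<And>u. s < u \<Longrightarrow> u < e \<Longrightarrow> - 1 < D u \<and> K u < K s + 1/2"
    unfolding eventually_at_right_field by auto
  \<comment> \<open>Each application of the bound halves the admissible lower bound on \<open>[s, e)\<close>.\<close>
  have halving: "- (1 / 2 ^ n) \<le> D u" if "s \<le> u" "u < e" for u n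
    using that
  proof (induction n arbitrary: u)
    case 0
    then show ?case using e(2)[of u] Ds by (cases "u = s") auto
  next
    case (Suc n)
    show ?case
    proof (cases "u = s")
      case True
      then show ?thesis using Ds by (simp add: order_trans[of _ 0])
    next
      case False
      then have "K u - K s \<le> 1/2" using e(2)[of u] Suc by auto
      then have "1 / 2 ^ n * (K u - K s) \<le> 1 / 2 ^ n * (1/2)" by (intro mult_left_mono) auto
      moreover have "- (1 / 2 ^ n * (K u - K s)) \<le> D u"
        by (rule bound) (use Ts Ds Suc in auto)
      ultimately show ?thesis by simp
    qed
  qed
  obtain v where v: "v \<in> B" "v < e"
    using cInf_lessD[of B e] e(1) \<open>t \<in> B\<close> unfolding s_def by auto
  have "s \<le> v" unfolding s_def by (rule cInf_lower[OF v(1) bdd])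
  have "(\<lambda>n. - ((1 / 2) ^ n)) \<longlonglongrightarrow> - (0::real)"
    by (intro tendsto_intros LIMSEQ_realpow_zero) auto
  then have "- 0 \<le> D v"
    by (rule LIMSEQ_le_const2) (use halving[OF \<open>s \<le> v\<close> v(2)] in \<open>auto simp: power_divide\<close>)
  with v show False by (auto simp: B_def)
qed


section \<open>Left limits and integrals of coefficients along paths\<close>

lemma left_lim_tendsto:
  "cadlag f \<Longrightarrow> 0 < u \<Longrightarrow> (f \<longlongrightarrow> left_lim f u) (at_left u)"
  unfolding cadlag_def left_lim_def
  using tendsto_Lim[OF trivial_limit_at_left_real] by fastforce

lemma tendsto_left_lim_nth:
  fixes f :: "real \<Rightarrow> real ^ 'n"
  assumes "cadlag f" "0 < u"
  shows "((\<lambda>v. f v $ k) \<longlongrightarrow> left_lim f u $ k) (at_left u)"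
  by (rule tendsto_vec_nth[OF left_lim_tendsto[OF assms]])

lemma eventually_at_left_between: "(r::real) < u \<Longrightarrow> eventually (\<lambda>v. r < v \<and> v < u) (at_left u)"
  using eventually_at_left_real[of r u] by (auto elim: eventually_mono)

text \<open>
  Only the values on \<open>[r,u)\<close> enter; thus bounds that hold up to, but not at, a time \<open>t\<close> are inherited by
  the integrands on \<open>(r,t]\<close>.
\<close>
lemma left_lim_nth_diff_ge:
  fixes f g :: "real \<Rightarrow> real ^ 'n"
  assumes "cadlag f" "cadlag g" "0 \<le> r" "r < u"
    and ge: "\<And>v. r \<le> v \<Longrightarrow> v < u \<Longrightarrow> c \<le> f v $ k - g v $ k"
  shows "c \<le> left_lim f u $ k - left_lim g u $ k"
proof (rule tendsto_lowerbound)
  show "((\<lambda>v. f v $ k - g v $ k) \<longlongrightarrow> left_lim f u $ k - left_lim g u $ k) (at_left u)"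
    by (intro tendsto_diff tendsto_left_lim_nth) (use assms in auto)
  show "eventually (\<lambda>v. c \<le> f v $ k - g v $ k) (at_left u)"
    using eventually_at_left_between[OF \<open>r < u\<close>] by eventually_elim (use ge in auto)
qed (rule trivial_limit_at_left_real)

lemma left_lim_nth_eq:
  fixes f g :: "real \<Rightarrow> real ^ 'n"
  assumes "cadlag f" "cadlag g" "0 \<le> r" "r < u"
    and "\<And>v. r \<le> v \<Longrightarrow> v < u \<Longrightarrow> f v $ k = g v $ k"
  shows "left_lim f u $ k = left_lim g u $ k"
  using left_lim_nth_diff_ge[of f g r u 0 k] left_lim_nth_diff_ge[of g f r u 0 k] assms by auto

lemma left_lim_nonneg:
  fixes f :: "real \<Rightarrow> real ^ 'n"
  assumes "cadlag f" and nonneg: "\<And>t k. 0 \<le> t \<Longrightarrow> 0 \<le> f t $ k"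
  shows "0 \<le> left_lim f u"
proof (cases "u \<le> 0")
  case True
  then show ?thesis using nonneg[of 0] by (simp add: left_lim_def less_eq_vec_def)
next
  case False
  have "0 \<le> left_lim f u $ k" for k
  proof (rule tendsto_lowerbound[OF tendsto_left_lim_nth])
    show "eventually (\<lambda>v. 0 \<le> f v $ k) (at_left u)"
      using eventually_at_left_between[of 0 u] False
      by (auto elim!: eventually_mono intro: nonneg)
  qed (use assms False in auto)
  then show ?thesis by (simp add: less_eq_vec_def)
qed

text \<open>
  On the grid of mesh \<open>1 / n\<close>, the largest grid point strictly below \<open>u\<close> is a Borel function of \<open>u\<close>
  with countably many values, and it tends to \<open>u\<close> strictly from the left.
\<close>
lemma borel_measurable_left_lim:
  fixes f :: "real \<Rightarrow> 'a :: metric_space"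
  assumes f: "cadlag f"
  shows "left_lim f \<in> borel_measurable borel"
proof (rule borel_measurable_LIMSEQ_metric)
  define p where "p n k = max 0 ((real_of_int k - 1) / real (Suc n))" for n k
  show "(\<lambda>u. f (p n \<lceil>real (Suc n) * u\<rceil>)) \<in> borel_measurable borel" for n
    by (rule measurable_compose[where f = "\<lambda>u. \<lceil>real (Suc n) * u\<rceil>" and g = "\<lambda>k. f (p n k)"
          and N = "count_space UNIV"]) simp_all
  fix u :: real
  show "(\<lambda>n. f (p n \<lceil>real (Suc n) * u\<rceil>)) \<longlonglongrightarrow> left_lim f u"
  proof (cases "u \<le> 0")
    case True
    have "p n \<lceil>real (Suc n) * u\<rceil> = 0" for n
    proof -
      have "real (Suc n) * u \<le> 0" using True by (simp add: mult_nonneg_nonpos)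
      then have "\<lceil>real (Suc n) * u\<rceil> \<le> 0" by simp
      then have "real_of_int \<lceil>real (Suc n) * u\<rceil> - 1 \<le> 0" by simp
      then have "(real_of_int \<lceil>real (Suc n) * u\<rceil> - 1) / real (Suc n) \<le> 0"
        by (rule divide_nonpos_pos) simp
      then show ?thesis unfolding p_def by simp
    qed
    then show ?thesis using True by (simp add: left_lim_def)
  next
    case False
    have upper: "p n \<lceil>real (Suc n) * u\<rceil> < u" for n
    proof -
      have "real_of_int \<lceil>real (Suc n) * u\<rceil> - 1 < real (Suc n) * u" by linarith
      then have "(real_of_int \<lceil>real (Suc n) * u\<rceil> - 1) / real (Suc n) < u"
        by (simp add: field_simps)
      then show ?thesis using False unfolding p_def by simp
    qed
    have lower: "u - 1 / real (Suc n) \<le> p n \<lceil>real (Suc n) * u\<rceil>" for n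
    proof -
      have "real (Suc n) * u - 1 \<le> real_of_int \<lceil>real (Suc n) * u\<rceil> - 1" by linarith
      then have "(real (Suc n) * u - 1) / real (Suc n) \<le> (real_of_int \<lceil>real (Suc n) * u\<rceil> - 1) / real (Suc n)"
        by (rule divide_right_mono) simp
      moreover have "(real (Suc n) * u - 1) / real (Suc n) = u - 1 / real (Suc n)"
        by (simp add: field_simps)
      ultimately show ?thesis unfolding p_def by linarith
    qed
    have grid: "(\<lambda>n. u - 1 / real (Suc n)) \<longlonglongrightarrow> u - 0"
      by (intro tendsto_intros LIMSEQ_Suc[OF lim_1_over_n])
    have "(\<lambda>n. p n \<lceil>real (Suc n) * u\<rceil>) \<longlonglongrightarrow> u"
    proof (rule tendsto_sandwich)
      show "(\<lambda>n. u - 1 / real (Suc n)) \<longlonglongrightarrow> u" using grid by simp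
      show "eventually (\<lambda>n. u - 1 / real (Suc n) \<le> p n \<lceil>real (Suc n) * u\<rceil>) sequentially"
        by (rule always_eventually) (rule allI, rule lower)
      show "eventually (\<lambda>n. p n \<lceil>real (Suc n) * u\<rceil> \<le> u) sequentially"
        by (rule always_eventually) (rule allI, rule less_imp_le[OF upper])
    qed (rule tendsto_const)
    moreover have "eventually (\<lambda>n. p n \<lceil>real (Suc n) * u\<rceil> \<in> {..<u} \<and> p n \<lceil>real (Suc n) * u\<rceil> \<noteq> u) sequentially"
    proof (intro always_eventually allI)
      show "p n \<lceil>real (Suc n) * u\<rceil> \<in> {..<u} \<and> p n \<lceil>real (Suc n) * u\<rceil> \<noteq> u" for n
        using upper[of n] by simp
    qed
    ultimately have "filterlim (\<lambda>n. p n \<lceil>real (Suc n) * u\<rceil>) (at_left u) sequentially"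
      unfolding filterlim_at by blast
    moreover have "(f \<longlongrightarrow> left_lim f u) (at_left u)"
      using left_lim_tendsto[OF f, of u] False by simp
    ultimately show ?thesis by (rule filterlim_compose[rotated])
  qed
qed

lemma monotone_right_continuous_imp_cadlag:
  fixes f :: "real \<Rightarrow> real ^ 'n"
  assumes mono: "\<And>k. mono_on {0..} (\<lambda>t. f t $ k)"
    and cont: "\<And>k t. 0 \<le> t \<Longrightarrow> continuous (at_right t) (\<lambda>t. f t $ k)"
  shows "cadlag f"
  unfolding cadlag_def
proof (intro conjI allI impI)
  fix t :: real assume "0 \<le> t"
  then show "continuous (at_right t) f"
    using cont unfolding continuous_within by (auto intro!: vec_tendstoI)
next
  fix t :: real assume "0 < t"
  have le: "f u $ k \<le> f v $ k" if "0 \<le> u" "u \<le> v" for u v k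
    using mono[of k] that by (auto simp: mono_on_def)
  have bdd: "bdd_above ((\<lambda>u. f u $ k) ` {0..<t})" for k
    by (rule bdd_aboveI[of _ "f t $ k"]) (auto intro: le)
  have "((\<lambda>u. f u $ k) \<longlongrightarrow> (SUP u\<in>{0..<t}. f u $ k)) (at_left t)" for k
  proof (rule increasing_tendsto)
    show "eventually (\<lambda>u. f u $ k \<le> (SUP u\<in>{0..<t}. f u $ k)) (at_left t)"
      using eventually_at_left_between[OF \<open>0 < t\<close>]
      by eventually_elim (auto intro!: cSUP_upper bdd)
  next
    fix x assume "x < (SUP u\<in>{0..<t}. f u $ k)"
    then obtain v where v: "0 \<le> v" "v < t" "x < f v $ k"
      using less_cSUP_iff[OF _ bdd, of x k] \<open>0 < t\<close> by auto
    show "eventually (\<lambda>u. x < f u $ k) (at_left t)"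
      using eventually_at_left_between[OF v(2)] 
      by eventually_elim (use v(1,3) le[of v _ k] in \<open>force intro: less_le_trans\<close>)
  qed
  then have "(f \<longlongrightarrow> (\<chi> k. SUP u\<in>{0..<t}. f u $ k)) (at_left t)"
    by (intro vec_tendstoI) simp
  then show "\<exists>y. (f \<longlongrightarrow> y) (at_left t)" ..
qed

text \<open>
  The class of scalar coefficients that can be integrated along a pair of paths in the orthant;
  the entries of \<open>b\<close>, of \<open>R\<close> and of \<open>R\<inverse> b\<close> belong to it.
\<close>
definition admissible_coeff :: "(real \<Rightarrow> real ^ 'n \<Rightarrow> real ^ 'n \<Rightarrow> real) \<Rightarrow> bool" where
  "admissible_coeff f \<longleftrightarrow>
     continuous_on coeff_dom (\<lambda>(t, l, w). f t l w) \<and>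
     (\<exists>B. \<forall>t\<ge>0. \<forall>l\<ge>0. \<forall>w\<ge>0. \<bar>f t l w\<bar> \<le> B)"

lemma admissible_coeff_bounded:
  "admissible_coeff f \<Longrightarrow> \<exists>B. \<forall>t\<ge>0. \<forall>l\<ge>0. \<forall>w\<ge>0. \<bar>f t l w\<bar> \<le> B"
  unfolding admissible_coeff_def by (rule conjunct2)

lemma closed_coeff_dom: "closed (coeff_dom :: (real \<times> (real ^ 'n) \<times> (real ^ 'n)) set)"
  unfolding coeff_dom_def by (intro closed_Times closed_eucl_atLeast)

lemma set_integrable_coeff_path:
  fixes L W :: "real \<Rightarrow> real ^ 'n"
  assumes f: "admissible_coeff f" and "cadlag L" "cadlag W"
    and nonneg: "\<And>t k. 0 \<le> t \<Longrightarrow> 0 \<le> L t $ k" "\<And>t k. 0 \<le> t \<Longrightarrow> 0 \<le> W t $ k"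
    and M: "sets M = sets borel" and A: "A \<in> sets borel" "A \<subseteq> {0..}" "emeasure M A < \<infinity>"
  shows "set_integrable M A (\<lambda>u. f u (left_lim L u) (left_lim W u))"
proof -
  let ?p = "\<lambda>u. (u, left_lim L u, left_lim W u)"
  let ?F = "\<lambda>x. indicator coeff_dom x *\<^sub>R (case x of (t, l, w) \<Rightarrow> f t l w)"
  have F: "?F \<in> borel_measurable borel"
    using f borel_closed[OF closed_coeff_dom]
    by (intro borel_measurable_continuous_on_indicator) (auto simp: admissible_coeff_def)
  have p: "?p \<in> borel_measurable borel"
    by (intro borel_measurable_Pair borel_measurable_left_lim assms) auto
  have "(\<lambda>u. ?F (?p u)) \<in> borel_measurable borel"
    using measurable_compose[OF p F] .
  then have meas: "(\<lambda>u. ?F (?p u)) \<in> borel_measurable M"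
    using M by (simp add: measurable_def sets_eq_imp_space_eq[OF M])
  have ll: "0 \<le> left_lim L u" "0 \<le> left_lim W u" for u
    by (intro left_lim_nonneg assms; assumption)+
  have ind: "indicator coeff_dom (?p u) = (1::real)" if "u \<in> A" for u
    using that A ll by (auto simp: coeff_dom_def indicator_def)
  from admissible_coeff_bounded[OF f]
  obtain B where "\<forall>t\<ge>0. \<forall>l\<ge>0. \<forall>w\<ge>0. \<bar>f t l w\<bar> \<le> B" ..
  note B = this[rule_format]
  have bound: "norm (?F (?p u)) \<le> B" if "u \<in> A" for u
  proof -
    have "0 \<le> u" using that A by auto
    then show ?thesis using B[OF _ ll] by (simp add: ind[OF that])
  qed
  have *: "set_integrable M A (\<lambda>u. ?F (?p u))"
    unfolding set_integrable_def
  proof (rule integrableI_bounded_set_indicator[OF _ meas])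
    show "AE u in M. u \<in> A \<longrightarrow> norm (?F (?p u)) \<le> B"
      using bound by (intro AE_I2) blast
  qed (use A M in simp_all)
  show ?thesis
    by (rule set_integrable_cong[OF refl refl, THEN iffD1, OF _ *]) (simp add: ind)
qed

text \<open>
  The Bochner integral of a function that is not measurable is \<open>0\<close>, so this integrability is what gives
  the integral of the upper drift \<open>\<beta>\<^sub>i\<close> its intended value.
\<close>
lemma set_integrable_sup_coeff:
  assumes f: "admissible_coeff f"
  shows "set_integrable lborel {0..t} (\<lambda>s. SUP w\<in>{0..}. f s 0 (w :: real ^ 'n))"
proof -
  from admissible_coeff_bounded[OF f]
  obtain B where B: "\<forall>t\<ge>0. \<forall>l\<ge>0. \<forall>w\<ge>0. \<bar>f t l w\<bar> \<le> B" ..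
  have bounds: "f s 0 w \<le> B" "- B \<le> f s 0 w" if "0 \<le> s" "0 \<le> w" for s w
    using B[rule_format, OF that(1) order_refl that(2)] by linarith+
  have bdd: "bdd_above ((\<lambda>w. f s 0 w) ` {0..})" if "0 \<le> s" for s
    by (rule bdd_aboveI2[of _ _ B]) (simp add: bounds that)
  let ?S = "\<lambda>s. SUP w\<in>{0..}. f s 0 w"
  have cont: "continuous_on {0..} (\<lambda>s. f s 0 w)" if "0 \<le> w" for w
  proof -
    have "continuous_on {0..} (\<lambda>s. (case (s, 0, w) of (t, l, w) \<Rightarrow> f t l w))"
      by (rule continuous_on_compose2[where t = coeff_dom and g = "\<lambda>(t, l, w). f t l w"])
         (use f that in \<open>auto simp: admissible_coeff_def coeff_dom_def intro!: continuous_intros\<close>)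
    then show ?thesis by simp
  qed
  \<comment> \<open>A supremum of continuous functions is lower semicontinuous.\<close>
  have "?S \<in> borel_measurable (restrict_space borel {0..})"
  proof (rule borel_measurable_iff_greater[THEN iffD2], rule allI)
    fix a
    have eq: "{s \<in> space (restrict_space borel {0..}). a < ?S s}
              = (\<Union>w\<in>{0..}. {0..} \<inter> (\<lambda>s. f s 0 w) -` {a<..})"
      using less_cSUP_iff[OF _ bdd, of _ a] by (auto simp: space_restrict_space)
    have "openin (top_of_set {0..}) (\<Union>w\<in>{0..}. {0..} \<inter> (\<lambda>s. f s 0 w) -` {a<..})"
      by (rule openin_Union, clarify, rule continuous_openin_preimage_gen[OF cont]) auto
    then obtain U where "open U" and U: "(\<Union>w\<in>{0..}. {0..} \<inter> (\<lambda>s. f s 0 w) -` {a<..}) = {0..} \<inter> U"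
      unfolding openin_open by blast
    have "{0..} \<inter> U \<in> sets (restrict_space borel {0..})"
      using \<open>open U\<close> by (simp add: sets_restrict_space)
    then show "{s \<in> space (restrict_space borel {0..}). a < ?S s} \<in> sets (restrict_space borel {0..})"
      unfolding eq U .
  qed
  then have meas: "(\<lambda>s. indicator {0..} s *\<^sub>R ?S s) \<in> borel_measurable lborel"
    by (subst (asm) borel_measurable_restrict_space_iff) auto
  have bound: "\<bar>?S s\<bar> \<le> B" if "0 \<le> s" for s
  proof -
    have "?S s \<le> B" by (rule cSUP_least) (simp_all add: bounds that)
    moreover have "f s 0 0 \<le> ?S s" by (rule cSUP_upper[OF _ bdd[OF that]]) simp
    moreover have "- B \<le> f s 0 0" by (rule bounds(2)[OF that order_refl])
    ultimately show ?thesis by (simp add: abs_le_iff)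
  qed
  have *: "set_integrable lborel {0..t} (\<lambda>s. indicator {0..} s *\<^sub>R ?S s)"
    unfolding set_integrable_def
  proof (rule integrableI_bounded_set_indicator[OF _ meas])
    show "AE s in lborel. s \<in> {0..t} \<longrightarrow> norm (indicator {0..} s *\<^sub>R ?S s) \<le> B"
    proof (intro AE_I2 impI)
      fix s assume "s \<in> {0..t}"
      then show "norm (indicator {0..} s *\<^sub>R ?S s) \<le> B" using bound[of s] by simp
    qed
  qed (simp_all add: emeasure_lborel_Icc_eq)
  show ?thesis
    by (rule set_integrable_cong[OF refl refl, THEN iffD1, OF _ *]) simp
qed

lemma coeff_path_integral_le_sup:
  fixes L W :: "real \<Rightarrow> real ^ 'n"
  assumes f: "admissible_coeff f" and "cadlag L" "cadlag W"
    and nonneg: "\<And>t k. 0 \<le> t \<Longrightarrow> 0 \<le> L t $ k" "\<And>t k. 0 \<le> t \<Longrightarrow> 0 \<le> W t $ k"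
    and indep: "\<And>t l w. 0 \<le> t \<Longrightarrow> 0 \<le> l \<Longrightarrow> 0 \<le> w \<Longrightarrow> f t l w = f t 0 w"
  shows "(LBINT u:{0..t}. f u (left_lim L u) (left_lim W u)) \<le> (LBINT s:{0..t}. SUP w\<in>{0..}. f s 0 w)"
proof (rule set_integral_mono)
  show "set_integrable lborel {0..t} (\<lambda>u. f u (left_lim L u) (left_lim W u))"
    by (rule set_integrable_coeff_path[OF assms(1-5)]) (simp_all add: emeasure_lborel_Icc_eq)
  fix u assume u: "u \<in> {0..t}"
  from admissible_coeff_bounded[OF f]
  obtain B where B: "\<forall>t\<ge>0. \<forall>l\<ge>0. \<forall>w\<ge>0. \<bar>f t l w\<bar> \<le> B" ..
  have ll: "0 \<le> left_lim L u" "0 \<le> left_lim W u"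
    by (intro left_lim_nonneg assms; assumption)+
  have "bdd_above ((\<lambda>w. f u 0 w) ` {0..})"
  proof (rule bdd_aboveI2[of _ _ B])
    fix w :: "real ^ 'n" assume "w \<in> {0..}"
    then have "\<bar>f u 0 w\<bar> \<le> B" using B u by simp
    then show "f u 0 w \<le> B" by linarith
  qed
  then have "f u 0 (left_lim W u) \<le> (SUP w\<in>{0..}. f u 0 w)"
    by (rule cSUP_upper[rotated]) (simp add: ll)
  also have "f u 0 (left_lim W u) = f u (left_lim L u) (left_lim W u)"
    by (rule indep[symmetric, OF _ ll]) (use u in simp)
  finally show "f u (left_lim L u) (left_lim W u) \<le> (SUP w\<in>{0..}. f u 0 w)" .
qed (rule set_integrable_sup_coeff[OF f])

lemma set_integral_diff_ge:
  fixes f g :: "real \<Rightarrow> real"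
  assumes f: "set_integrable M A f" and g: "set_integrable M A g"
    and A: "A \<in> sets M" "emeasure M A < \<infinity>"
    and ge: "\<And>u. u \<in> A \<Longrightarrow> c \<le> f u - g u"
  shows "c * measure M A \<le> (LINT u:A|M. f u) - (LINT u:A|M. g u)"
proof -
  have "(LINT u:A|M. c) \<le> (LINT u:A|M. f u - g u)"
  proof (rule set_integral_mono)
    show "set_integrable M A (\<lambda>u. c)"
      unfolding set_integrable_def by (rule integrableI_bounded_set_indicator[OF A(1) _ A(2), of _ "norm c"]) simp_all
    show "set_integrable M A (\<lambda>u. f u - g u)"
      by (rule set_integral_diff(1)[OF f g])
  qed (rule ge)
  also have "\<dots> = (LINT u:A|M. f u) - (LINT u:A|M. g u)"
    by (rule set_integral_diff(2)[OF f g])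
  also have "(LINT u:A|M. c) = c * measure M A"
    using A by (simp add: set_lebesgue_integral_def)
  finally show ?thesis .
qed


section \<open>Feedforward coefficients and their solutions\<close>

text \<open>
  If \<open>w\<close> and \<open>w'\<close> agree below coordinate \<open>i\<close>, and \<open>f\<close> depends only on the coordinates up to \<open>i\<close>, then \<open>f\<close>
  is in effect a function of the \<open>i\<close>-th coordinate alone. Monotonicity gives the bound \<open>0\<close> when
  \<open>w' $ i \<le> w $ i\<close>; the Lipschitz estimate is applied only in the opposite case. A two-sided Lipschitz
  bound would not do: at an atom of \<open>dL\<close> it could turn a positive difference of two solutions into a
  negative one.
\<close>
lemma one_sided_lipschitz:
  fixes f :: "real \<Rightarrow> real ^ 'n::{finite,linorder} \<Rightarrow> real ^ 'n::{finite,linorder} \<Rightarrow> real"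
  assumes lip: "C-lipschitz_on ({0..} \<times> {0..}) (\<lambda>(l, w). f t l w)"
    and mono: "mono_on {0..} (f t l')"
    and indep: "f t l w = f t l' w"
    and local: "\<And>v. 0 \<le> v \<Longrightarrow> agree_upto i w v \<Longrightarrow> f t l' w = f t l' v"
    and nonneg: "0 \<le> l'" "0 \<le> w" "0 \<le> w'"
    and lower: "\<And>k. k < i \<Longrightarrow> w $ k = w' $ k" and m: "0 \<le> m" "- m \<le> w $ i - w' $ i"
  shows "- (C * m) \<le> f t l w - f t l' w'"
proof -
  have C: "0 \<le> C" using lip by (rule lipschitz_on_nonneg)
  \<comment> \<open>Only the \<open>i\<close>-th coordinate of \<open>w'\<close> has to be changed to reach a point where \<open>f\<close> equals its value at \<open>w\<close>.\<close>
  define v where "v = w' + (w $ i - w' $ i) *\<^sub>R axis i 1"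
  have v_nth: "v $ k = (if k = i then w $ i else w' $ k)" for k
    by (simp add: v_def axis_def)
  have v: "0 \<le> v" using nonneg by (simp add: less_eq_vec_def v_nth)
  have "agree_upto i w v" unfolding agree_upto_def v_nth using lower by (auto simp: order_le_less)
  then have fv: "f t l w = f t l' v" using indep local[OF v] by simp
  show ?thesis
  proof (cases "w' $ i \<le> w $ i")
    case True
    then have "w' \<le> v" by (simp add: less_eq_vec_def v_nth)
    then have "f t l' w' \<le> f t l' v" using mono nonneg v by (auto simp: mono_on_def)
    moreover have "0 \<le> C * m" using C m by simp
    ultimately show ?thesis using fv by simp
  next
    case False
    have "dist (f t l' v) (f t l' w') \<le> C * dist (l', v) (l', w')"
      using lipschitz_onD[OF lip, of "(l', v)" "(l', w')"] nonneg v by simp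
    also have "dist (l', v) (l', w') = \<bar>w $ i - w' $ i\<bar>"
      by (simp add: dist_Pair_Pair dist_norm v_def)
    also have "C * \<bar>w $ i - w' $ i\<bar> \<le> C * m"
      using C m False by (intro mult_left_mono) auto
    finally show ?thesis using fv by (simp add: dist_real_def)
  qed
qed

locale feedforward =
  fixes b :: "real \<Rightarrow> real ^ 'n::{finite,linorder} \<Rightarrow> real ^ 'n::{finite,linorder} \<Rightarrow> real ^ 'n::{finite,linorder}"
    and P R :: "real \<Rightarrow> real ^ 'n::{finite,linorder} \<Rightarrow> real ^ 'n::{finite,linorder} \<Rightarrow>
                  real ^ 'n::{finite,linorder} ^ 'n::{finite,linorder}"
  assumes R_eq: "R = reflection P"
    and A1: "cond_A1 b P" and A3: "cond_A3 b R" and B1: "cond_B1 b R" and B2: "cond_B2 b R"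
begin

lemma R_nth: "R t l w $ i $ j = (if i = j then 1 else 0) - P t l w $ j $ i"
  by (simp add: R_eq reflection_def mat_def transpose_def)

lemma R_diag: "0 \<le> t \<Longrightarrow> 0 \<le> l \<Longrightarrow> 0 \<le> w \<Longrightarrow> R t l w $ i $ i = 1"
  and R_upper: "0 \<le> t \<Longrightarrow> 0 \<le> l \<Longrightarrow> 0 \<le> w \<Longrightarrow> i < j \<Longrightarrow> R t l w $ i $ j = 0"
  using B1[unfolded cond_B1_def, THEN spec[of _ i]] by simp_all

lemma local:
  assumes "0 \<le> t" "0 \<le> l" "0 \<le> w" "0 \<le> w'" "agree_upto i w w'"
  shows b_local: "b t l w $ i = b t l w' $ i"
    and R_local: "j < i \<Longrightarrow> R t l w $ i $ j = R t l w' $ i $ j"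
proof -
  have "agree_upto i l l" by (simp add: agree_upto_def)
  then show "b t l w $ i = b t l w' $ i" "j < i \<Longrightarrow> R t l w $ i $ j = R t l w' $ i $ j"
    using B1[unfolded cond_B1_def, THEN spec[of _ i]] assms by simp_all
qed

lemma mono_w:
  assumes "0 \<le> t" "0 \<le> l"
  shows "mono_on {0..} (\<lambda>w. b t l w $ i)" "mono_on {0..} (\<lambda>w. R t l w $ i $ j)"
  using A3 assms unfolding cond_A3_def by simp_all

lemma R_off_diag: "0 \<le> t \<Longrightarrow> 0 \<le> l \<Longrightarrow> 0 \<le> w \<Longrightarrow> i \<noteq> j \<Longrightarrow> R t l w $ i $ j \<le> 0"
  using A1 unfolding cond_A1_def R_nth by simp

lemma indep_l:
  assumes "0 \<le> t" "0 \<le> l" "0 \<le> l'" "0 \<le> w"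
  shows "b t l w = b t l' w" "R t l w = R t l' w"
  using B2[unfolded cond_B2_def, rule_format, of t l l' w] assms by simp_all

lemma admissible_b: "admissible_coeff (\<lambda>t l w. b t l w $ i)"
proof -
  have "continuous_on coeff_dom (\<lambda>(t, l, w). b t l w)" "bounded ((\<lambda>(t, l, w). b t l w) ` coeff_dom)"
    using A1 unfolding cond_A1_def by simp_all
  note b = this
  from b(1) have "continuous_on coeff_dom (\<lambda>(t, l, w). b t l w $ i)"
    unfolding case_prod_beta by (intro continuous_intros)
  moreover have "\<exists>B. \<forall>t\<ge>0. \<forall>l\<ge>0. \<forall>w\<ge>0. \<bar>b t l w $ i\<bar> \<le> B"
  proof -
    from b(2) obtain B where "\<forall>x\<in>(\<lambda>(t, l, w). b t l w) ` coeff_dom. norm x \<le> B"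
      unfolding bounded_iff ..
    then have B: "norm (b t l w) \<le> B" if "0 \<le> t" "0 \<le> l" "0 \<le> w" for t l w
      using that by (simp add: coeff_dom_def)
    show ?thesis
      by (intro exI[of _ B] allI impI) (rule order_trans[OF component_le_norm_cart B])
  qed
  ultimately show ?thesis unfolding admissible_coeff_def by (rule conjI)
qed

lemma admissible_R: "admissible_coeff (\<lambda>t l w. R t l w $ i $ j)"
proof -
  have "continuous_on coeff_dom (\<lambda>(t, l, w). P t l w)" "bounded ((\<lambda>(t, l, w). P t l w) ` coeff_dom)"
    using A1 unfolding cond_A1_def by simp_all
  note P = this
  from P(1) have "continuous_on coeff_dom (\<lambda>(t, l, w). R t l w $ i $ j)"
    unfolding R_nth case_prod_beta by (intro continuous_intros)
  moreover have "\<exists>B. \<forall>t\<ge>0. \<forall>l\<ge>0. \<forall>w\<ge>0. \<bar>R t l w $ i $ j\<bar> \<le> B"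
  proof -
    from P(2) obtain B where "\<forall>x\<in>(\<lambda>(t, l, w). P t l w) ` coeff_dom. norm x \<le> B"
      unfolding bounded_iff ..
    then have B: "norm (P t l w) \<le> B" if "0 \<le> t" "0 \<le> l" "0 \<le> w" for t l w
      using that by (simp add: coeff_dom_def)
    have entry: "\<bar>P t l w $ j $ i\<bar> \<le> norm (P t l w)" for t l w
      by (rule order_trans[OF component_le_norm_cart Finite_Cartesian_Product.norm_nth_le])
    have "\<bar>R t l w $ i $ j\<bar> \<le> 1 + B" if "0 \<le> t" "0 \<le> l" "0 \<le> w" for t l w
      using entry[of t l w] B[OF that] unfolding R_nth by (auto simp: abs_if split: if_splits)
    then show ?thesis by (intro exI[of _ "1 + B"] allI impI)
  qed
  ultimately show ?thesis unfolding admissible_coeff_def by (rule conjI)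
qed

text \<open>
  One constant serves \<open>b\<close> and all entries of \<open>R\<close> left of the diagonal in row \<open>i\<close>, which are the coefficients
  of the \<open>i\<close>-th equation.
\<close>
lemma coeff_comparison:
  shows "\<exists>C\<ge>0. \<forall>t\<ge>0. \<forall>l\<ge>0. \<forall>l'\<ge>0. \<forall>w\<ge>0. \<forall>w'\<ge>0. \<forall>m\<ge>0.
           (\<forall>k<i. w $ k = w' $ k) \<longrightarrow> - m \<le> w $ i - w' $ i \<longrightarrow>
           - (C * m) \<le> b t l w $ i - b t l' w' $ i \<and>
           (\<forall>j<i. - (C * m) \<le> R t l w $ i $ j - R t l' w' $ i $ j)"
proof -
  have Cb': "\<exists>C. \<forall>t\<ge>0. C-lipschitz_on ({0..} \<times> {0..}) (\<lambda>(l, w). b t l w $ i)"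
    and CP': "\<forall>j. \<exists>C. \<forall>t\<ge>0. C-lipschitz_on ({0..} \<times> {0..}) (\<lambda>(l, w). P t l w $ j $ i)"
    using A1 unfolding cond_A1_def by simp_all
  from Cb' obtain Cb where "\<forall>t\<ge>0. Cb-lipschitz_on ({0..} \<times> {0..}) (\<lambda>(l, w). b t l w $ i)" ..
  note Cb = this[rule_format]
  from choice[OF CP'] obtain CP
    where "\<forall>j. \<forall>t\<ge>0. (CP j)-lipschitz_on ({0..} \<times> {0..}) (\<lambda>(l, w). P t l w $ j $ i)" ..
  note CP = this[rule_format]
  have CR: "(CP j)-lipschitz_on ({0..} \<times> {0..}) (\<lambda>(l, w). R t l w $ i $ j)" if "0 \<le> t" for t j
  proof (rule lipschitz_onI)
    fix x y :: "(real ^ 'n::{finite,linorder}) \<times> (real ^ 'n::{finite,linorder})"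
    assume "x \<in> {0..} \<times> {0..}" "y \<in> {0..} \<times> {0..}"
    from lipschitz_onD[OF CP[OF that] this, of j]
    show "dist (case x of (l, w) \<Rightarrow> R t l w $ i $ j) (case y of (l, w) \<Rightarrow> R t l w $ i $ j) \<le> CP j * dist x y"
      by (simp add: R_nth dist_real_def case_prod_beta abs_minus_commute)
  qed (rule lipschitz_on_nonneg[OF CP[OF that]])
  have CP0: "0 \<le> CP j" for j using lipschitz_on_nonneg[OF CP[of 0]] by simp
  have Cb0: "0 \<le> Cb" using lipschitz_on_nonneg[OF Cb[of 0]] by simp
  define C where "C = Cb + (\<Sum>j\<in>UNIV. CP j)"
  have C: "Cb \<le> C" "CP j \<le> C" for j
    using Cb0 CP0 member_le_sum[of j UNIV CP] by (auto simp: C_def intro!: sum_nonneg add_increasing)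
  show ?thesis
  proof (intro exI[of _ C] conjI allI impI)
    show "0 \<le> C" using C Cb0 by simp
  next
    fix t :: real and l l' w w' :: "real ^ 'n::{finite,linorder}" and m :: real
    assume nn: "0 \<le> t" "0 \<le> l" "0 \<le> l'" "0 \<le> w" "0 \<le> w'" "0 \<le> m"
      and lower: "\<forall>k<i. w $ k = w' $ k" and m: "- m \<le> w $ i - w' $ i"
    have "- (Cb * m) \<le> b t l w $ i - b t l' w' $ i"
    proof (rule one_sided_lipschitz[where i = i and m = m, OF Cb])
      show "mono_on {0..} (\<lambda>w. b t l' w $ i)" using nn by (intro mono_w)
      show "b t l w $ i = b t l' w $ i" using indep_l(1)[OF nn(1-4)] by simp
      show "b t l' w $ i = b t l' v $ i" if "0 \<le> v" "agree_upto i w v" for v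
        using nn that by (intro b_local)
    qed (use nn lower m in auto)
    moreover have "Cb * m \<le> C * m" using C nn by (intro mult_right_mono)
    ultimately show "- (C * m) \<le> b t l w $ i - b t l' w' $ i" by linarith
    fix j assume "j < i"
    have "- (CP j * m) \<le> R t l w $ i $ j - R t l' w' $ i $ j"
    proof (rule one_sided_lipschitz[where i = i and m = m, OF CR])
      show "mono_on {0..} (\<lambda>w. R t l' w $ i $ j)" using nn by (intro mono_w)
      show "R t l w $ i $ j = R t l' w $ i $ j" using indep_l(2)[OF nn(1-4)] by simp
      show "R t l' w $ i $ j = R t l' v $ i $ j" if "0 \<le> v" "agree_upto i w v" for v
        using nn that \<open>j < i\<close> by (intro R_local)
    qed (use nn lower m in auto)
    moreover have "CP j * m \<le> C * m" using C nn by (intro mult_right_mono)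
    ultimately show "- (C * m) \<le> R t l w $ i $ j - R t l' w' $ i $ j" by linarith
  qed
qed

end

locale feedforward_solution = feedforward b P R
  for b :: "real \<Rightarrow> real ^ 'n::{finite,linorder} \<Rightarrow> real ^ 'n::{finite,linorder} \<Rightarrow> real ^ 'n::{finite,linorder}"
    and P R :: "real \<Rightarrow> real ^ 'n::{finite,linorder} \<Rightarrow> real ^ 'n::{finite,linorder} \<Rightarrow>
                  real ^ 'n::{finite,linorder} ^ 'n::{finite,linorder}" +
  fixes Y W L :: "real \<Rightarrow> real ^ 'n::{finite,linorder}"
  assumes sol: "skorohod_solution b R Y W L"
begin

lemma W_cadlag: "cadlag W"
  and L_nonneg: "0 \<le> t \<Longrightarrow> 0 \<le> L t $ i"
  and W_nonneg: "0 \<le> t \<Longrightarrow> 0 \<le> W t $ i"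
  and L_regulator: "regulator (\<lambda>t. L t $ i)"
  and complementarity: "(\<integral>\<^sup>+ t \<in> {0..}. indicator {t. W t $ i > 0} t \<partial>stieltjes (\<lambda>t. L t $ i)) = 0"
proof -
  have "cadlag W" and L0: "L 0 = 0" and paths: "\<forall>i. mono_on {0..} (\<lambda>t. L t $ i) \<and>
          (\<forall>t\<ge>0. 0 \<le> L t $ i) \<and> (\<forall>t\<ge>0. continuous (at_right t) (\<lambda>t. L t $ i)) \<and>
          (\<forall>t\<ge>0. 0 \<le> W t $ i) \<and>
          (\<integral>\<^sup>+ t \<in> {0..}. indicator {t. W t $ i > 0} t \<partial>stieltjes (\<lambda>t. L t $ i)) = 0"
    using sol unfolding skorohod_solution_def by - (elim conjE, assumption)+
  then show "cadlag W" by simp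
  show "0 \<le> t \<Longrightarrow> 0 \<le> L t $ i" "0 \<le> t \<Longrightarrow> 0 \<le> W t $ i"
    using paths[rule_format, of i] by simp_all
  show "regulator (\<lambda>t. L t $ i)"
    using paths[rule_format, of i] L0 unfolding regulator_def by simp
  show "(\<integral>\<^sup>+ t \<in> {0..}. indicator {t. W t $ i > 0} t \<partial>stieltjes (\<lambda>t. L t $ i)) = 0"
    using paths[rule_format, of i] by (elim conjE)
qed

lemma L_cadlag: "cadlag L"
  by (rule monotone_right_continuous_imp_cadlag) (use L_regulator in \<open>auto simp: regulator_def\<close>)

lemma left_lims_nonneg: "0 \<le> left_lim L u" "0 \<le> left_lim W u"
  by (rule left_lim_nonneg; simp add: L_cadlag W_cadlag L_nonneg W_nonneg)+

lemma W_right_continuous: "0 \<le> t \<Longrightarrow> continuous (at_right t) (\<lambda>t. W t $ i)"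
  using W_cadlag unfolding cadlag_def continuous_within by (simp add: tendsto_vec_nth)

text \<open>
  On \<open>S\<close> the integrand of the complementarity condition is \<open>1\<close>, so its integral, which is \<open>0\<close>, is at
  least the mass of \<open>S\<close>.
\<close>
lemma L_flat_off_boundary:
  assumes S: "S \<in> sets borel" "S \<subseteq> {0..}" and pos: "\<And>u. u \<in> S \<Longrightarrow> 0 < W u $ i"
  shows "emeasure (stieltjes (\<lambda>t. L t $ i)) S = 0"
proof -
  have "emeasure (stieltjes (\<lambda>t. L t $ i)) S = (\<integral>\<^sup>+ t. indicator S t \<partial>stieltjes (\<lambda>t. L t $ i))"
    using S by simp
  also have "\<dots> \<le> (\<integral>\<^sup>+ t \<in> {0..}. indicator {t. W t $ i > 0} t \<partial>stieltjes (\<lambda>t. L t $ i))"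
    by (rule nn_integral_mono) (use S pos in \<open>auto simp: indicator_def\<close>)
  also have "\<dots> = 0"
    by (rule complementarity)
  finally show ?thesis by simp
qed

lemma integrable_path:
  assumes "admissible_coeff f" "sets M = sets borel" "A \<in> sets borel" "A \<subseteq> {0..t}"
    and fin: "emeasure M {0..t} < \<infinity>"
  shows "set_integrable M A (\<lambda>u. f u (left_lim L u) (left_lim W u))"
proof (rule set_integrable_coeff_path[OF assms(1) L_cadlag W_cadlag L_nonneg W_nonneg assms(2,3)])
  show "A \<subseteq> {0..}" using assms(4) by auto
  have "emeasure M A \<le> emeasure M {0..t}" using assms by (intro emeasure_mono) auto
  then show "emeasure M A < \<infinity>" using fin by (rule le_less_trans)
qed

lemma integrable_path_lborel:
  assumes "admissible_coeff f" "A \<in> sets borel" "A \<subseteq> {0..t}"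
  shows "set_integrable lborel A (\<lambda>u. f u (left_lim L u) (left_lim W u))"
  by (rule integrable_path[OF assms(1) _ assms(2,3)]) (simp_all add: emeasure_lborel_Icc_eq)

lemma integrable_path_stieltjes:
  assumes "admissible_coeff f" "regulator g" "A \<in> sets borel" "A \<subseteq> {0..t}" "0 \<le> t"
  shows "set_integrable (stieltjes g) A (\<lambda>u. f u (left_lim L u) (left_lim W u))"
  by (rule integrable_path[OF assms(1) _ assms(3,4)])
     (simp_all add: emeasure_stieltjes_finite assms del: infinity_ennreal_def)

lemma integral_path_split:
  fixes f :: "real \<Rightarrow> real"
  assumes "set_integrable M {0..t} f" "sets M = sets borel" "0 \<le> r" "r \<le> t"
  shows "(LINT u:{0..t}|M. f u) = (LINT u:{0..r}|M. f u) + (LINT u:{r<..t}|M. f u)"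
proof -
  have "{0..t} = {0..r} \<union> {r<..t}" using assms by auto
  moreover have "set_integrable M {0..r} f" "set_integrable M {r<..t} f"
    by (rule set_integrable_subset[OF assms(1)]; use assms in auto)+
  moreover have "{0..r} \<inter> {r<..t} = {}" by auto
  ultimately show ?thesis by (simp add: set_integral_Un)
qed

lemma equation:
  assumes "0 \<le> t"
  shows "W t $ i = Y t $ i + (LBINT u:{0..t}. b u (left_lim L u) (left_lim W u) $ i)
          + (\<Sum>j\<in>UNIV. LINT u:{0..t}|stieltjes (\<lambda>t. L t $ j). R u (left_lim L u) (left_lim W u) $ i $ j)"
  using sol assms unfolding skorohod_solution_def by simp

lemma diagonal_integral:
  assumes "0 \<le> r" "r \<le> t"
  shows "(LINT u:{r<..t}|stieltjes (\<lambda>t. L t $ i). R u (left_lim L u) (left_lim W u) $ i $ i) = L t $ i - L r $ i"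
proof -
  have "(LINT u:{r<..t}|stieltjes (\<lambda>t. L t $ i). R u (left_lim L u) (left_lim W u) $ i $ i)
        = (LINT u:{r<..t}|stieltjes (\<lambda>t. L t $ i). 1)"
    by (rule set_lebesgue_integral_cong) (use assms R_diag left_lims_nonneg in auto)
  also have "\<dots> = L t $ i - L r $ i"
    using measure_stieltjes_Ioc[OF L_regulator assms] emeasure_stieltjes_Ioc[OF L_regulator assms]
    by (simp add: set_lebesgue_integral_def)
  finally show ?thesis .
qed

text \<open>
  The triangular form of the \<open>i\<close>-th equation: entries of \<open>R\<close> right of the diagonal vanish, and the diagonal
  entry \<open>1\<close> turns its integral into an increment of \<open>L $ i\<close>.
\<close>
lemma increment:
  assumes rt: "0 \<le> r" "r \<le> t"
  shows "W t $ i - W r $ i = Y t $ i - Y r $ i + (LBINT u:{r<..t}. b u (left_lim L u) (left_lim W u) $ i)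
          + (\<Sum>j\<in>{..<i}. LINT u:{r<..t}|stieltjes (\<lambda>t. L t $ j). R u (left_lim L u) (left_lim W u) $ i $ j)
          + (L t $ i - L r $ i)"
proof -
  let ?b = "\<lambda>u. b u (left_lim L u) (left_lim W u) $ i"
  let ?R = "\<lambda>j u. R u (left_lim L u) (left_lim W u) $ i $ j"
  let ?M = "\<lambda>j. stieltjes (\<lambda>t. L t $ j)"
  have "0 \<le> t" using rt by simp
  have "(LBINT u:{0..t}. ?b u) = (LBINT u:{0..r}. ?b u) + (LBINT u:{r<..t}. ?b u)"
    by (rule integral_path_split[OF integrable_path_lborel[where t = t, OF admissible_b]]) (use rt in auto)
  moreover have "(LINT u:{0..t}|?M j. ?R j u) = (LINT u:{0..r}|?M j. ?R j u) + (LINT u:{r<..t}|?M j. ?R j u)" for j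
    by (rule integral_path_split[OF integrable_path_stieltjes[where t = t, OF admissible_R L_regulator]])
       (use rt in auto)
  then have "(\<Sum>j\<in>UNIV. LINT u:{0..t}|?M j. ?R j u)
      = (\<Sum>j\<in>UNIV. LINT u:{0..r}|?M j. ?R j u) + (\<Sum>j\<in>UNIV. LINT u:{r<..t}|?M j. ?R j u)"
    by (simp add: sum.distrib)
  moreover have "(\<Sum>j\<in>UNIV. LINT u:{r<..t}|?M j. ?R j u)
      = (\<Sum>j\<in>{..<i}. LINT u:{r<..t}|?M j. ?R j u) + (L t $ i - L r $ i)"
  proof -
    have upper: "(LINT u:{r<..t}|?M j. ?R j u) = 0" if "i < j" for j
    proof -
      have "(LINT u:{r<..t}|?M j. ?R j u) = (LINT u:{r<..t}|?M j. 0)"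
        by (rule set_lebesgue_integral_cong) (use rt that R_upper left_lims_nonneg in auto)
      then show ?thesis by simp
    qed
    have "(\<Sum>j\<in>UNIV. LINT u:{r<..t}|?M j. ?R j u) = (\<Sum>j\<in>{..i}. LINT u:{r<..t}|?M j. ?R j u)"
      by (rule sum.mono_neutral_right) (auto simp: not_le upper)
    also have "{..i} = insert i {..<i}" by auto
    finally show ?thesis using diagonal_integral[OF rt, of i] by simp
  qed
  ultimately show ?thesis
    using equation[OF \<open>0 \<le> t\<close>, of i] equation[OF rt(1), of i] by linarith
qed

text \<open>
  \<open>L $ i\<close> has to grow after \<open>T\<close>, and it can do so only while \<open>W $ i = 0\<close>.
\<close>
lemma hits_boundary:
  assumes unbounded: "\<forall>M. \<exists>t\<ge>0. M < L t $ i" and "0 \<le> T"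
  shows "\<exists>u>T. W u $ i = 0"
proof (rule ccontr)
  assume no_hit: "\<not> (\<exists>u>T. W u $ i = 0)"
  obtain t where t: "0 \<le> t" "L T $ i < L t $ i" using unbounded by blast
  have "T \<le> t"
  proof (rule ccontr)
    assume "\<not> T \<le> t"
    then have "L t $ i \<le> L T $ i" using t by (intro regulator_mono[OF L_regulator]) simp_all
    with t show False by simp
  qed
  have "emeasure (stieltjes (\<lambda>t. L t $ i)) {T<..t} = 0"
  proof (rule L_flat_off_boundary)
    fix u assume "u \<in> {T<..t}"
    then have "W u $ i \<noteq> 0" "0 \<le> W u $ i" using no_hit W_nonneg[of u i] \<open>0 \<le> T\<close> by auto
    then show "0 < W u $ i" by simp
  qed (use \<open>0 \<le> T\<close> in auto)
  then show False
    using emeasure_stieltjes_Ioc[OF L_regulator \<open>0 \<le> T\<close> \<open>T \<le> t\<close>, of i] t by (simp add: ennreal_eq_0_iff)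
qed

end


section \<open>Two solutions driven by translates of the same path\<close>

locale feedforward_pair =
  fst: feedforward_solution b P R Y W L + snd: feedforward_solution b P R Y' W' L'
  for b :: "real \<Rightarrow> real ^ 'n::{finite,linorder} \<Rightarrow> real ^ 'n::{finite,linorder} \<Rightarrow> real ^ 'n::{finite,linorder}"
    and P R :: "real \<Rightarrow> real ^ 'n::{finite,linorder} \<Rightarrow> real ^ 'n::{finite,linorder} \<Rightarrow>
                  real ^ 'n::{finite,linorder} ^ 'n::{finite,linorder}"
    and Y W L Y' W' L' :: "real \<Rightarrow> real ^ 'n::{finite,linorder}" +
  assumes same_increments: "\<And>r t i. 0 \<le> r \<Longrightarrow> 0 \<le> t \<Longrightarrow> Y t $ i - Y r $ i = Y' t $ i - Y' r $ i"
begin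

lemma swapped: "feedforward_pair b P R Y' W' L' Y W L"
  by unfold_locales (rule same_increments[symmetric])

text \<open>
  The offset \<open>c\<close> cannot be omitted: once the states coincide, the two regulators have equal increments,
  but in general they have already grown by different amounts.
\<close>
definition agree_below :: "'n \<Rightarrow> real \<Rightarrow> bool" where
  "agree_below i T \<longleftrightarrow> 0 \<le> T \<and>
     (\<forall>k<i. \<exists>c. \<forall>t\<ge>T. W t $ k = W' t $ k \<and> L t $ k - L' t $ k = c)"

lemma agree_below_mono: "agree_below i T \<Longrightarrow> T \<le> T' \<Longrightarrow> agree_below i T'"
  unfolding agree_below_def by (meson order_trans)

lemma agree_below_W: "agree_below i T \<Longrightarrow> k < i \<Longrightarrow> T \<le> t \<Longrightarrow> W t $ k = W' t $ k"
  unfolding agree_below_def by blast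

lemma R_integral_dL_eq:
  assumes T: "agree_below i T" and "j < i" "T \<le> r" "r \<le> t"
  shows "(LINT u:{r<..t}|stieltjes (\<lambda>t. L t $ j). R u (left_lim L u) (left_lim W u) $ i $ j)
       = (LINT u:{r<..t}|stieltjes (\<lambda>t. L' t $ j). R u (left_lim L u) (left_lim W u) $ i $ j)"
proof -
  have "0 \<le> T" using T by (simp add: agree_below_def)
  then have "0 \<le> r" "0 \<le> t" using assms by simp_all
  obtain c where c: "\<And>u. T \<le> u \<Longrightarrow> L u $ j - L' u $ j = c"
    using T \<open>j < i\<close> unfolding agree_below_def by blast
  show ?thesis
  proof (rule stieltjes_set_integral_cong_increments[OF fst.L_regulator snd.L_regulator])
    show "set_integrable (stieltjes (\<lambda>t. L t $ j)) {r<..t} (\<lambda>u. R u (left_lim L u) (left_lim W u) $ i $ j)"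
      by (rule fst.integrable_path_stieltjes[where t = t, OF fst.admissible_R fst.L_regulator])
         (use \<open>0 \<le> r\<close> \<open>0 \<le> t\<close> in auto)
    show "L u $ j - L' u $ j = c" if "r \<le> u" "u \<le> t" for u
      using that assms by (intro c) simp
  qed (use assms \<open>0 \<le> r\<close> in simp_all)
qed

lemma increment_difference:
  assumes T: "agree_below i T" and "T \<le> r" "r \<le> t"
  defines "B \<equiv> \<lambda>u. b u (left_lim L u) (left_lim W u) $ i" and "B' \<equiv> \<lambda>u. b u (left_lim L' u) (left_lim W' u) $ i"
    and "Q \<equiv> \<lambda>j u. R u (left_lim L u) (left_lim W u) $ i $ j"
    and "Q' \<equiv> \<lambda>j u. R u (left_lim L' u) (left_lim W' u) $ i $ j"
  shows "(W t $ i - W' t $ i) - (W r $ i - W' r $ i)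
       = ((LBINT u:{r<..t}. B u) - (LBINT u:{r<..t}. B' u))
       + (\<Sum>j\<in>{..<i}. (LINT u:{r<..t}|stieltjes (\<lambda>t. L' t $ j). Q j u)
                     - (LINT u:{r<..t}|stieltjes (\<lambda>t. L' t $ j). Q' j u))
       + (L t $ i - L r $ i) - (L' t $ i - L' r $ i)"
proof -
  have "0 \<le> T" using T by (simp add: agree_below_def)
  then have r: "0 \<le> r" "0 \<le> t" using assms by simp_all
  have "(\<Sum>j\<in>{..<i}. LINT u:{r<..t}|stieltjes (\<lambda>t. L t $ j). Q j u)
      = (\<Sum>j\<in>{..<i}. LINT u:{r<..t}|stieltjes (\<lambda>t. L' t $ j). Q j u)"
    unfolding Q_def by (rule sum.cong) (use R_integral_dL_eq[OF T _ \<open>T \<le> r\<close> \<open>r \<le> t\<close>] in auto)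
  then show ?thesis
    using fst.increment[OF r(1) \<open>r \<le> t\<close>, of i] snd.increment[OF r(1) \<open>r \<le> t\<close>, of i]
      same_increments[OF r, of i]
    unfolding B_def B'_def Q_def Q'_def sum_subtractf by linarith
qed

text \<open>
  Once the coordinates below \<open>i\<close> have merged, the order of the two solutions in coordinate \<open>i\<close> is never
  reversed. Let \<open>D = W $ i - W' $ i\<close>. While \<open>D < 0\<close>, the larger solution \<open>W' $ i\<close> is positive, so \<open>L' $ i\<close>
  does not grow, whereas growth of \<open>L $ i\<close> only increases \<open>D\<close>. The other terms are differences of
  coefficients integrated against \<open>dt\<close> and against \<open>dL' $ j\<close> with \<open>j < i\<close>, which is the same measure for both
  solutions. If \<open>D \<ge> -m\<close> on the interval, these terms are at least \<open>-C m\<close> times the mass, which is the bound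
  required by \<open>nonneg_of_local_self_bound\<close>.
\<close>
lemma order_preserved:
  assumes T: "agree_below i T" and start: "W' T $ i \<le> W T $ i" and "T \<le> t"
  shows "W' t $ i \<le> W t $ i"
proof -
  have "0 \<le> T" using T by (simp add: agree_below_def)
  obtain C where C: "0 \<le> C" and cmp': "\<forall>t\<ge>0. \<forall>l\<ge>0. \<forall>l'\<ge>0. \<forall>w\<ge>0. \<forall>w'\<ge>0. \<forall>m\<ge>0.
           (\<forall>k<i. w $ k = w' $ k) \<longrightarrow> - m \<le> w $ i - w' $ i \<longrightarrow>
           - (C * m) \<le> b t l w $ i - b t l' w' $ i \<and>
           (\<forall>j<i. - (C * m) \<le> R t l w $ i $ j - R t l' w' $ i $ j)"
    using fst.coeff_comparison[of i] by (elim exE conjE)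
  define D where "D t = W t $ i - W' t $ i" for t
  define \<Lambda> where "\<Lambda> t = t + (\<Sum>j\<in>{..<i}. L' t $ j)" for t
  have \<Lambda>_mono: "\<Lambda> r \<le> \<Lambda> t" if "0 \<le> r" "r \<le> t" for r t
    unfolding \<Lambda>_def using that by (intro add_mono sum_mono regulator_mono[OF snd.L_regulator])
  have "0 \<le> D t"
  proof (rule nonneg_of_local_self_bound[where D = D and T = T and K = "\<lambda>t. C * \<Lambda> t"])
    fix s assume "T \<le> s"
    then have "0 \<le> s" using \<open>0 \<le> T\<close> by simp
    then show "continuous (at_right s) D"
      unfolding D_def by (intro continuous_diff fst.W_right_continuous snd.W_right_continuous)
    have "continuous (at_right s) (\<lambda>t. L' t $ j)" for j
      using snd.L_regulator[of j] \<open>0 \<le> s\<close> unfolding regulator_def by simp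
    then show "continuous (at_right s) (\<lambda>t. C * \<Lambda> t)"
      unfolding \<Lambda>_def by (intro continuous_mult continuous_add continuous_sum continuous_const continuous_ident)
  next
    show "0 \<le> D T" using start by (simp add: D_def)
  next
    fix s t m
    assume st: "T \<le> s" "s \<le> t" and Ds: "0 \<le> D s" and m: "0 \<le> m"
      and ge: "\<And>u. s \<le> u \<Longrightarrow> u < t \<Longrightarrow> - m \<le> D u"
    have s0: "0 \<le> s" using st \<open>0 \<le> T\<close> by simp
    have Cm: "0 \<le> C * m" using C m by simp
    show "- (m * (C * \<Lambda> t - C * \<Lambda> s)) \<le> D t"
    proof (cases "0 \<le> D t")
      case True
      have "0 \<le> (C * m) * (\<Lambda> t - \<Lambda> s)"
        using Cm \<Lambda>_mono[OF s0 st(2)] by simp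
      then have "- (m * (C * \<Lambda> t - C * \<Lambda> s)) \<le> 0" by (simp add: algebra_simps)
      then show ?thesis using True by (rule order_trans)
    next
      case False
      show ?thesis
      proof (rule field_le_epsilon)
        fix \<eta> :: real assume "0 < \<eta>"
        \<comment> \<open>When \<open>D < 0\<close>, the second solution is off the boundary, so that \<open>L' $ i\<close> is constant.\<close>
        have flat: "emeasure (stieltjes (\<lambda>t. L' t $ i)) S = 0"
          if "S \<in> sets borel" "S \<subseteq> {0..}" "\<And>u. u \<in> S \<Longrightarrow> D u < 0" for S
        proof (rule snd.L_flat_off_boundary[OF that(1,2)])
          fix u assume "u \<in> S"
          then have "D u < 0" "0 \<le> u" using that by auto
          then show "0 < W' u $ i" using fst.W_nonneg[of u i] by (simp add: D_def)
        qed
        have "D t < 0" using False by simp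
        have "\<exists>r. s \<le> r \<and> r < t \<and> 0 \<le> D r \<and> L' t $ i - L' r $ i < \<eta>"
          by (rule last_nonneg_time_before_flat_stretch[OF snd.L_regulator s0 st(2) _ Ds \<open>D t < 0\<close> \<open>0 < \<eta>\<close>])
             (rule flat)
        then obtain r where r: "s \<le> r" "r < t" "0 \<le> D r" "L' t $ i - L' r $ i < \<eta>"
          by (elim exE conjE)
        have r0: "0 \<le> r" "r \<le> t" "0 \<le> t" "T \<le> r" using r s0 st by simp_all
        have cmp: "- (C * m) \<le> b u (left_lim L u) (left_lim W u) $ i - b u (left_lim L' u) (left_lim W' u) $ i"
                  "j < i \<Longrightarrow> - (C * m) \<le> R u (left_lim L u) (left_lim W u) $ i $ j
                                       - R u (left_lim L' u) (left_lim W' u) $ i $ j"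
          if "u \<in> {r<..t}" for u j
        proof -
          have u: "r < u" "u \<le> t" "0 \<le> u" using that r0 by auto
          have low: "\<forall>k<i. left_lim W u $ k = left_lim W' u $ k"
          proof (intro allI impI)
            fix k assume "k < i"
            show "left_lim W u $ k = left_lim W' u $ k"
              by (rule left_lim_nth_eq[OF fst.W_cadlag snd.W_cadlag r0(1) u(1)])
                 (use agree_below_W[OF T \<open>k < i\<close>] r0 in simp)
          qed
          have diff: "- m \<le> left_lim W u $ i - left_lim W' u $ i"
            by (rule left_lim_nth_diff_ge[OF fst.W_cadlag snd.W_cadlag r0(1) u(1)])
               (use ge r u in \<open>simp add: D_def\<close>)
          have "- (C * m) \<le> b u (left_lim L u) (left_lim W u) $ i - b u (left_lim L' u) (left_lim W' u) $ i \<and>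
             (\<forall>j<i. - (C * m) \<le> R u (left_lim L u) (left_lim W u) $ i $ j
                                - R u (left_lim L' u) (left_lim W' u) $ i $ j)"
            by (rule cmp'[rule_format, OF u(3) fst.left_lims_nonneg(1) snd.left_lims_nonneg(1)
                  fst.left_lims_nonneg(2) snd.left_lims_nonneg(2) m low[rule_format] diff])
          then show "- (C * m) \<le> b u (left_lim L u) (left_lim W u) $ i - b u (left_lim L' u) (left_lim W' u) $ i"
            "j < i \<Longrightarrow> - (C * m) \<le> R u (left_lim L u) (left_lim W u) $ i $ j
                                       - R u (left_lim L' u) (left_lim W' u) $ i $ j"
            by simp_all
        qed
        let ?B = "\<lambda>u. b u (left_lim L u) (left_lim W u) $ i"
        let ?B' = "\<lambda>u. b u (left_lim L' u) (left_lim W' u) $ i"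
        let ?Q = "\<lambda>j u. R u (left_lim L u) (left_lim W u) $ i $ j"
        let ?Q' = "\<lambda>j u. R u (left_lim L' u) (left_lim W' u) $ i $ j"
        let ?M = "\<lambda>j. stieltjes (\<lambda>t. L' t $ j)"
        have sub: "{r<..t} \<subseteq> {0..t}" using r0 by auto
        have drift: "- (C * m) * (t - r) \<le> (LBINT u:{r<..t}. ?B u) - (LBINT u:{r<..t}. ?B' u)"
          using set_integral_diff_ge[OF fst.integrable_path_lborel[OF fst.admissible_b _ sub]
              snd.integrable_path_lborel[OF fst.admissible_b _ sub] _ _ cmp(1)] r0
          by (simp add: emeasure_lborel_Ioc)
        have "- (C * m) * (L' t $ j - L' r $ j)
              \<le> (LINT u:{r<..t}|?M j. ?Q j u) - (LINT u:{r<..t}|?M j. ?Q' j u)" if "j < i" for j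
          using set_integral_diff_ge[OF fst.integrable_path_stieltjes[OF fst.admissible_R snd.L_regulator _ sub r0(3)]
              snd.integrable_path_stieltjes[OF fst.admissible_R snd.L_regulator _ sub r0(3)] _ _ cmp(2)[OF _ that]] 
          by (simp add: emeasure_stieltjes_Ioc[OF snd.L_regulator r0(1,2)]
              measure_stieltjes_Ioc[OF snd.L_regulator r0(1,2)])
        then have "(\<Sum>j\<in>{..<i}. - (C * m) * (L' t $ j - L' r $ j))
              \<le> (\<Sum>j\<in>{..<i}. (LINT u:{r<..t}|?M j. ?Q j u) - (LINT u:{r<..t}|?M j. ?Q' j u))"
          by (intro sum_mono) simp
        then have reflection: "- (C * m) * ((\<Sum>j\<in>{..<i}. L' t $ j) - (\<Sum>j\<in>{..<i}. L' r $ j))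
              \<le> (\<Sum>j\<in>{..<i}. (LINT u:{r<..t}|?M j. ?Q j u) - (LINT u:{r<..t}|?M j. ?Q' j u))"
          by (simp only: sum_subtractf[symmetric] sum_distrib_left)
        have "L r $ i \<le> L t $ i" by (rule regulator_mono[OF fst.L_regulator r0(1,2)])
        then have "- (C * m) * (t - r) + - (C * m) * ((\<Sum>j\<in>{..<i}. L' t $ j) - (\<Sum>j\<in>{..<i}. L' r $ j)) - \<eta>
              \<le> D t - D r"
          using increment_difference[OF T r0(4,2)] drift reflection r(4) unfolding D_def by linarith
        moreover have "- (C * m) * (t - r) + - (C * m) * ((\<Sum>j\<in>{..<i}. L' t $ j) - (\<Sum>j\<in>{..<i}. L' r $ j))
              = - ((C * m) * (\<Lambda> t - \<Lambda> r))"
          by (simp add: \<Lambda>_def algebra_simps)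
        moreover have "(C * m) * (\<Lambda> t - \<Lambda> r) \<le> (C * m) * (\<Lambda> t - \<Lambda> s)"
          using \<Lambda>_mono[OF s0 r(1)] Cm by (intro mult_left_mono) simp_all
        moreover have "(C * m) * (\<Lambda> t - \<Lambda> s) = m * (C * \<Lambda> t - C * \<Lambda> s)"
          by (simp add: algebra_simps)
        ultimately show "- (m * (C * \<Lambda> t - C * \<Lambda> s)) \<le> D t + \<eta>"
          using r(3) by linarith
      qed
    qed
  qed (rule \<open>T \<le> t\<close>)
  then show ?thesis by (simp add: D_def)
qed

end

context feedforward_pair
begin

interpretation swap: feedforward_pair b P R Y' W' L' Y W L
  by (rule swapped)

lemma agree_below_swap: "agree_below i T \<Longrightarrow> swap.agree_below i T"
  unfolding agree_below_def swap.agree_below_def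
proof (elim conjE, intro conjI allI impI)
  fix k assume "\<forall>k<i. \<exists>c. \<forall>t\<ge>T. W t $ k = W' t $ k \<and> L t $ k - L' t $ k = c" and "k < i"
  then obtain c where c: "\<forall>t\<ge>T. W t $ k = W' t $ k \<and> L t $ k - L' t $ k = c" by blast
  show "\<exists>c. \<forall>t\<ge>T. W' t $ k = W t $ k \<and> L' t $ k - L t $ k = c"
    using c by (intro exI[of _ "- c"]) (auto simp: algebra_simps)
qed

text \<open>
  Equality at \<open>T\<close> is preserved since both inequalities are. All other terms of the two \<open>i\<close>-th equations then
  have equal increments, so the increments of \<open>L $ i\<close> and \<open>L' $ i\<close> are equal too.
\<close>
lemma stay_together:
  assumes T: "agree_below i T" and meet: "W T $ i = W' T $ i" and "T \<le> t"
  shows "W t $ i = W' t $ i" and "L t $ i - L' t $ i = L T $ i - L' T $ i"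
proof -
  have eq: "W t $ i = W' t $ i" if "T \<le> t" for t
    using order_preserved[OF T _ that] swap.order_preserved[OF agree_below_swap[OF T] _ that] meet by simp
  then show "W t $ i = W' t $ i" using \<open>T \<le> t\<close> .
  have "0 \<le> T" using T by (simp add: agree_below_def)
  have agree: "agree_upto i (left_lim W u) (left_lim W' u)" if "T < u" for u
    unfolding agree_upto_def
  proof (intro allI impI)
    fix k assume "k \<le> i"
    have "W v $ k = W' v $ k" if "T \<le> v" for v
      using agree_below_W[OF T _ that] eq[OF that] \<open>k \<le> i\<close> by (cases "k = i") simp_all
    then show "left_lim W u $ k = left_lim W' u $ k"
      by (intro left_lim_nth_eq[OF fst.W_cadlag snd.W_cadlag \<open>0 \<le> T\<close> that])
  qed
  have b_eq: "b u (left_lim L u) (left_lim W u) $ i = b u (left_lim L' u) (left_lim W' u) $ i"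
    and Q_eq: "j < i \<Longrightarrow> R u (left_lim L u) (left_lim W u) $ i $ j = R u (left_lim L' u) (left_lim W' u) $ i $ j"
    if "T < u" for u j
  proof -
    have "0 \<le> u" using that \<open>0 \<le> T\<close> by simp
    have nn: "0 \<le> left_lim L u" "0 \<le> left_lim L' u" "0 \<le> left_lim W u" "0 \<le> left_lim W' u"
      by (rule fst.left_lims_nonneg snd.left_lims_nonneg)+
    note drop_l = fst.indep_l[OF \<open>0 \<le> u\<close> nn(1-3)]
    show "b u (left_lim L u) (left_lim W u) $ i = b u (left_lim L' u) (left_lim W' u) $ i"
      unfolding drop_l by (rule fst.b_local[OF \<open>0 \<le> u\<close> nn(2-4) agree[OF that]])
    show "R u (left_lim L u) (left_lim W u) $ i $ j = R u (left_lim L' u) (left_lim W' u) $ i $ j" if "j < i"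
      unfolding drop_l by (rule fst.R_local[OF \<open>0 \<le> u\<close> nn(2-4) agree[OF \<open>T < u\<close>] that])
  qed
  have "(LBINT u:{T<..t}. b u (left_lim L u) (left_lim W u) $ i)
      = (LBINT u:{T<..t}. b u (left_lim L' u) (left_lim W' u) $ i)"
    by (rule set_lebesgue_integral_cong) (simp_all add: b_eq)
  moreover have "(LINT u:{T<..t}|stieltjes (\<lambda>t. L' t $ j). R u (left_lim L u) (left_lim W u) $ i $ j)
      = (LINT u:{T<..t}|stieltjes (\<lambda>t. L' t $ j). R u (left_lim L' u) (left_lim W' u) $ i $ j)" if "j < i" for j
    by (rule set_lebesgue_integral_cong) (simp_all add: Q_eq that)
  ultimately show "L t $ i - L' t $ i = L T $ i - L' T $ i"
    using increment_difference[OF T order_refl \<open>T \<le> t\<close>] eq[OF \<open>T \<le> t\<close>] meet by simp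
qed

text \<open>
  After the lower coordinates have merged, the solution that is ahead in coordinate \<open>i\<close> stays ahead and
  at some time is at \<open>0\<close>. The other one lies between \<open>0\<close> and it, so they meet at that time.
\<close>
lemma eventually_equal_coordinate:
  assumes unbounded: "\<And>i. \<forall>M. \<exists>t\<ge>0. M < L t $ i" and unbounded': "\<And>i. \<forall>M. \<exists>t\<ge>0. M < L' t $ i"
  shows "\<exists>c T. 0 \<le> T \<and> (\<forall>t\<ge>T. W t $ i = W' t $ i \<and> L t $ i - L' t $ i = c)"
proof (induction i rule: measure_induct_rule[of "\<lambda>i. card {..<i}"])
  case (less i)
  have "\<exists>c T. 0 \<le> T \<and> (\<forall>t\<ge>T. W t $ k = W' t $ k \<and> L t $ k - L' t $ k = c)" if "k < i" for k
    by (rule less) (use that in \<open>intro psubset_card_mono, auto\<close>)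
  then obtain c S where S: "\<And>k t. k < i \<Longrightarrow> S k \<le> t \<Longrightarrow> W t $ k = W' t $ k \<and> L t $ k - L' t $ k = c k"
    by metis
  define T where "T = Max (insert 0 (S ` {..<i}))"
  have "0 \<le> T" unfolding T_def by simp
  have "S k \<le> T" if "k < i" for k unfolding T_def using that by simp
  then have T: "agree_below i T"
    unfolding agree_below_def using \<open>0 \<le> T\<close> S by (meson order_trans)
  have "\<exists>u\<ge>T. W u $ i = W' u $ i"
  proof (cases "W' T $ i \<le> W T $ i")
    case True
    obtain u where u: "T < u" "W u $ i = 0"
      using fst.hits_boundary[OF unbounded \<open>0 \<le> T\<close>] by blast
    then have "W' u $ i \<le> 0" using order_preserved[OF T True, of u] by simp
    moreover have "0 \<le> W' u $ i" using u \<open>0 \<le> T\<close> by (intro snd.W_nonneg) simp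
    ultimately show ?thesis using u by (intro exI[of _ u]) simp
  next
    case False
    obtain u where u: "T < u" "W' u $ i = 0"
      using snd.hits_boundary[OF unbounded' \<open>0 \<le> T\<close>] by blast
    then have "W u $ i \<le> 0" using swap.order_preserved[OF agree_below_swap[OF T], of u] False by simp
    moreover have "0 \<le> W u $ i" using u \<open>0 \<le> T\<close> by (intro fst.W_nonneg) simp
    ultimately show ?thesis using u by (intro exI[of _ u]) simp
  qed
  then obtain u where u: "T \<le> u" "W u $ i = W' u $ i" by blast
  note together = stay_together[OF agree_below_mono[OF T u(1)] u(2)]
  show ?case
  proof (rule exI[of _ "L u $ i - L' u $ i"], rule exI[of _ u], intro conjI allI impI)
    show "0 \<le> u" using \<open>0 \<le> T\<close> u(1) by (rule order_trans)
  qed (fact together)+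
qed

lemma eventually_equal:
  assumes "\<And>i. \<forall>M. \<exists>t\<ge>0. M < L t $ i" and "\<And>i. \<forall>M. \<exists>t\<ge>0. M < L' t $ i"
  shows "\<exists>T\<ge>0. \<forall>t\<ge>T. W t = W' t"
proof -
  have "\<forall>i. \<exists>T. \<forall>t\<ge>T. W t $ i = W' t $ i"
    using eventually_equal_coordinate[OF assms] by blast
  then obtain S where S: "\<And>i t. S i \<le> t \<Longrightarrow> W t $ i = W' t $ i" by metis
  have "W t = W' t" if "Max (insert 0 (range S)) \<le> t" for t
    using that S by (simp add: vec_eq_iff)
  then show ?thesis by (intro exI[of _ "Max (insert 0 (range S))"]) simp
qed

end


section \<open>Unbounded regulators\<close>

text \<open>
  Here \<open>g\<close> will be a coordinate of a regulator. It has to compensate for the arbitrarily negative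
  values of the driving path with its largest drift, up to a constant \<open>\<kappa>\<close> that collects all initial values.
\<close>
lemma unbounded_of_liminf_cond:
  assumes lim: "liminf_cond X b i"
    and bound: "\<And>t. 0 \<le> t \<Longrightarrow> 0 \<le> \<kappa> + (X t $ i + (LBINT s:{0..t}. sup_drift b i s)) + g t"
  shows "\<forall>M. \<exists>t\<ge>0. M < (g t :: real)"
proof (rule allI, rule ccontr)
  fix M assume "\<not> (\<exists>t\<ge>0. M < g t)"
  then have g: "g t \<le> M" if "0 \<le> t" for t using that by auto
  let ?f = "\<lambda>t. X t $ i + (LBINT s:{0..t}. sup_drift b i s)"
  have "- (\<kappa> + M) \<le> ?f t" if "0 \<le> t" for t
    using bound[OF that] g[OF that] by linarith
  then have "eventually (\<lambda>t. ereal (- (\<kappa> + M)) \<le> ereal (?f t)) at_top"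
    by (intro eventually_mono[OF eventually_ge_at_top[of 0]]) simp
  then have "ereal (- (\<kappa> + M)) \<le> Liminf at_top (\<lambda>t. ereal (?f t))"
    by (rule Liminf_bounded)
  with lim show False by (simp add: liminf_cond_def)
qed

context feedforward_solution
begin

text \<open>
  The constant \<open>\<kappa>\<close> absorbs the contributions of the point \<open>0\<close>, so
  none of them has to be evaluated.
\<close>
lemma balance:
  "\<exists>\<kappa>. \<forall>t\<ge>0. W t $ i = \<kappa> + Y t $ i + (LBINT u:{0..t}. b u (left_lim L u) (left_lim W u) $ i)
     + (\<Sum>j\<in>{..<i}. LINT u:{0<..t}|stieltjes (\<lambda>t. L t $ j). R u (left_lim L u) (left_lim W u) $ i $ j)
     + L t $ i"
proof (intro exI[of _ "W 0 $ i - Y 0 $ i - (LBINT u:{0..0}. b u (left_lim L u) (left_lim W u) $ i) - L 0 $ i"]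
    allI impI)
  fix t :: real assume t: "0 \<le> t"
  have "(LBINT u:{0..t}. b u (left_lim L u) (left_lim W u) $ i)
      = (LBINT u:{0..0}. b u (left_lim L u) (left_lim W u) $ i)
      + (LBINT u:{0<..t}. b u (left_lim L u) (left_lim W u) $ i)"
    by (rule integral_path_split[OF integrable_path_lborel[where t = t, OF admissible_b]]) (use t in auto)
  with increment[OF order_refl t, of i]
  show "W t $ i = W 0 $ i - Y 0 $ i - (LBINT u:{0..0}. b u (left_lim L u) (left_lim W u) $ i) - L 0 $ i
     + Y t $ i + (LBINT u:{0..t}. b u (left_lim L u) (left_lim W u) $ i)
     + (\<Sum>j\<in>{..<i}. LINT u:{0<..t}|stieltjes (\<lambda>t. L t $ j). R u (left_lim L u) (left_lim W u) $ i $ j)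
     + L t $ i"
    by linarith
qed

text \<open>
  The entries of \<open>R\<close> off the diagonal are nonpositive, so the regulators \<open>L $ j\<close> with \<open>j < i\<close> can only
  lower \<open>W $ i\<close>; dropping them and replacing the drift by its supremum leaves \<open>L $ i\<close> as the only term
  that can keep \<open>W $ i\<close> nonnegative.
\<close>
lemma unbounded_regulator:
  assumes lim: "liminf_cond X b i" and shift: "\<And>t. Y t = a + X t"
  shows "\<forall>M. \<exists>t\<ge>0. M < L t $ i"
proof -
  from balance[of i] obtain \<kappa> where \<kappa>: "\<forall>t\<ge>0. W t $ i = \<kappa> + Y t $ i
     + (LBINT u:{0..t}. b u (left_lim L u) (left_lim W u) $ i)
     + (\<Sum>j\<in>{..<i}. LINT u:{0<..t}|stieltjes (\<lambda>t. L t $ j). R u (left_lim L u) (left_lim W u) $ i $ j)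
     + L t $ i" ..
  show ?thesis
  proof (rule unbounded_of_liminf_cond[OF lim])
    fix t :: real assume t: "0 \<le> t"
    have "(LBINT u:{0..t}. b u (left_lim L u) (left_lim W u) $ i) \<le> (LBINT s:{0..t}. sup_drift b i s)"
      unfolding sup_drift_def
    proof (rule coeff_path_integral_le_sup[OF admissible_b L_cadlag W_cadlag])
      show "b t l w $ i = b t 0 w $ i" if "0 \<le> t" "0 \<le> l" "0 \<le> w" for t l w
        using indep_l(1)[OF that(1,2) order_refl that(3)] by simp
    qed (simp_all add: L_nonneg W_nonneg)
    moreover have "(LINT u:{0<..t}|stieltjes (\<lambda>t. L t $ j). R u (left_lim L u) (left_lim W u) $ i $ j) \<le> 0"
      if "j < i" for j
    proof -
      have "(LINT u:{0<..t}|stieltjes (\<lambda>t. L t $ j). R u (left_lim L u) (left_lim W u) $ i $ j)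
          \<le> (LINT u:{0<..t}|stieltjes (\<lambda>t. L t $ j). 0)"
      proof (rule set_integral_mono)
        show "set_integrable (stieltjes (\<lambda>t. L t $ j)) {0<..t} (\<lambda>u. R u (left_lim L u) (left_lim W u) $ i $ j)"
          by (rule integrable_path_stieltjes[where t = t, OF admissible_R L_regulator]) (use t in auto)
        show "R u (left_lim L u) (left_lim W u) $ i $ j \<le> 0" if "u \<in> {0<..t}" for u
          using that \<open>j < i\<close> by (intro R_off_diag left_lims_nonneg) auto
      qed (simp add: set_integrable_def)
      then show ?thesis by simp
    qed
    then have "(\<Sum>j\<in>{..<i}. LINT u:{0<..t}|stieltjes (\<lambda>t. L t $ j). R u (left_lim L u) (left_lim W u) $ i $ j) \<le> 0"
      by (intro sum_nonpos) simp
    moreover note W_nonneg[OF t, of i] \<kappa>[rule_format, OF t]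
    ultimately show "0 \<le> (\<kappa> + a $ i) + (X t $ i + (LBINT s:{0..t}. sup_drift b i s)) + L t $ i"
      by (simp add: shift)
  qed
qed

end

section \<open>Constant reflection\<close>

lemma unit_lower_triangular_mult_nth:
  fixes C :: "real ^ 'n::{finite,linorder} ^ 'n::{finite,linorder}"
  assumes diag: "C $ i $ i = 1" and upper: "\<And>j. i < j \<Longrightarrow> C $ i $ j = 0"
  shows "(C *v x) $ i = x $ i + (\<Sum>j\<in>{..<i}. C $ i $ j * x $ j)"
proof -
  have "(C *v x) $ i = (\<Sum>j\<in>UNIV. C $ i $ j * x $ j)"
    by (simp add: matrix_vector_mult_def)
  also have "\<dots> = (\<Sum>j\<in>{..i}. C $ i $ j * x $ j)"
    by (rule sum.mono_neutral_right) (auto simp: not_le upper)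
  also have "{..i} = insert i {..<i}" by auto
  finally show ?thesis by (simp add: diag)
qed

text \<open>
  Forward substitution: \<open>x $ i = (C *v x) $ i - (\<Sum>j<i. C $ i $ j * x $ j)\<close>, where no term on the right is
  negative.
\<close>
lemma unit_lower_triangular_monotone:
  fixes C :: "real ^ 'n::{finite,linorder} ^ 'n::{finite,linorder}"
  assumes diag: "\<And>i. C $ i $ i = 1" and upper: "\<And>i j. i < j \<Longrightarrow> C $ i $ j = 0"
    and lower: "\<And>i j. j < i \<Longrightarrow> C $ i $ j \<le> 0" and Cx: "\<And>i. 0 \<le> (C *v x) $ i"
  shows "0 \<le> x $ i"
proof (induction i rule: measure_induct_rule[of "\<lambda>i. card {..<i}"])
  case (less i)
  have "0 \<le> x $ j" if "j < i" for j
    by (rule less) (use that in \<open>intro psubset_card_mono, auto\<close>)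
  then have "(\<Sum>j\<in>{..<i}. C $ i $ j * x $ j) \<le> 0"
    using lower by (intro sum_nonpos mult_nonpos_nonneg) auto
  then show ?case
    using unit_lower_triangular_mult_nth[OF diag upper, of i x] Cx[of i] by simp
qed

text \<open>
  The preceding lemma applied to \<open>x\<close> and \<open>- x\<close> gives a trivial kernel, and applied to \<open>matrix_inv C *v x\<close>
  gives that the inverse maps the orthant into itself.
\<close>
lemma unit_lower_triangular_inverse:
  fixes C :: "real ^ 'n::{finite,linorder} ^ 'n::{finite,linorder}"
  assumes diag: "\<And>i. C $ i $ i = 1" and upper: "\<And>i j. i < j \<Longrightarrow> C $ i $ j = 0"
    and lower: "\<And>i j. j < i \<Longrightarrow> C $ i $ j \<le> 0"
  shows "matrix_inv C ** C = mat 1" and "\<And>x i. (\<And>k. 0 \<le> x $ k) \<Longrightarrow> 0 \<le> (matrix_inv C *v x) $ i"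
proof -
  have "x = 0" if "C *v x = 0" for x
  proof -
    have "C *v (- x) = 0"
      using that by (simp add: matrix_vector_mult_def vec_eq_iff sum_negf)
    then have "0 \<le> x $ i" "0 \<le> (- x) $ i" for i
      using unit_lower_triangular_monotone[OF assms, of x] unit_lower_triangular_monotone[OF assms, of "- x"] that
      by simp_all
    then show ?thesis by (auto simp: vec_eq_iff intro: order_antisym)
  qed
  then have "invertible C"
    unfolding invertible_left_inverse matrix_left_invertible_ker by blast
  then have inv: "C ** matrix_inv C = mat 1 \<and> matrix_inv C ** C = mat 1"
    unfolding invertible_def matrix_inv_def by (rule someI_ex)
  then show "matrix_inv C ** C = mat 1" ..
  fix x :: "real ^ 'n::{finite,linorder}" and i assume x: "\<And>k. 0 \<le> x $ k"
  have "C *v (matrix_inv C *v x) = x"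
    using inv by (simp add: matrix_vector_mul_assoc)
  then have Cx: "0 \<le> (C *v (matrix_inv C *v x)) $ k" for k using x by simp
  show "0 \<le> (matrix_inv C *v x) $ i"
    by (rule unit_lower_triangular_monotone[OF diag upper lower Cx])
qed

lemma admissible_coeff_mult_matrix:
  assumes "\<And>k. admissible_coeff (\<lambda>t l w. f t l w $ k)"
  shows "admissible_coeff (\<lambda>t l w. (N *v f t l w) $ i)"
proof -
  have cont: "continuous_on coeff_dom (\<lambda>(t, l, w). f t l w $ k)" for k
    using assms[of k] by (simp add: admissible_coeff_def)
  have "continuous_on coeff_dom (\<lambda>(t, l, w). (N *v f t l w) $ i)"
    unfolding matrix_vector_mult_def case_prod_beta vec_lambda_beta
    by (intro continuous_intros cont[unfolded case_prod_beta])
  moreover have "\<forall>k. \<exists>B. \<forall>t\<ge>0. \<forall>l\<ge>0. \<forall>w\<ge>0. \<bar>f t l w $ k\<bar> \<le> B"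
    using admissible_coeff_bounded[OF assms] by (rule allI)
  from choice[OF this] obtain B where "\<forall>k. \<forall>t\<ge>0. \<forall>l\<ge>0. \<forall>w\<ge>0. \<bar>f t l w $ k\<bar> \<le> B k" ..
  note B = this[rule_format]
  have "\<bar>(N *v f t l w) $ i\<bar> \<le> (\<Sum>k\<in>UNIV. \<bar>N $ i $ k\<bar> * B k)" if "0 \<le> t" "0 \<le> l" "0 \<le> w" for t l w
    unfolding matrix_vector_mult_def vec_lambda_beta
    by (rule order_trans[OF sum_abs sum_mono])
       (unfold abs_mult, rule mult_left_mono[OF B[OF that] abs_ge_zero])
  then have "\<exists>B. \<forall>t\<ge>0. \<forall>l\<ge>0. \<forall>w\<ge>0. \<bar>(N *v f t l w) $ i\<bar> \<le> B"
    by (intro exI allI impI)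
  ultimately show ?thesis unfolding admissible_coeff_def by (intro conjI)
qed

text \<open>
  Multiplication of the equation by the inverse of \<open>R\<close> isolates \<open>L\<close>, and it keeps the left hand side
  \<open>matrix_inv C *v W\<close> nonnegative. From there the argument is that of \<open>unbounded_regulator\<close>.
\<close>
lemma (in feedforward_solution) unbounded_regulator_constant_reflection:
  assumes const: "\<And>t l w. 0 \<le> t \<Longrightarrow> 0 \<le> l \<Longrightarrow> 0 \<le> w \<Longrightarrow> R t l w = C"
    and lim: "liminf_cond (\<lambda>t. matrix_inv C *v X t) (\<lambda>s l w. matrix_inv C *v b s l w) i"
    and shift: "\<And>t. Y t = a + X t"
  shows "\<forall>M. \<exists>t\<ge>0. M < L t $ i"
proof -
  define N where "N = matrix_inv C"
  have C: "C = R 0 0 0" using const by simp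
  have diag: "C $ i $ i = 1" and upper: "i < j \<Longrightarrow> C $ i $ j = 0" and lower: "j < i \<Longrightarrow> C $ i $ j \<le> 0" for i j
    unfolding C using R_diag R_upper R_off_diag by simp_all
  have NC: "N ** C = mat 1" and N_nonneg: "\<And>x i. (\<And>k. 0 \<le> x $ k) \<Longrightarrow> 0 \<le> (N *v x) $ i"
    unfolding N_def by (rule unit_lower_triangular_inverse[OF diag upper lower]; assumption)+
  let ?I = "\<lambda>t k. LBINT u:{0..t}. b u (left_lim L u) (left_lim W u) $ k"
  have "\<exists>\<kappa>. \<forall>t\<ge>0. W t $ k = \<kappa> + Y t $ k + ?I t k + (C *v L t) $ k" for k
  proof -
    from balance[of k] obtain \<kappa> where \<kappa>: "\<forall>t\<ge>0. W t $ k = \<kappa> + Y t $ k + ?I t k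
       + (\<Sum>j\<in>{..<k}. LINT u:{0<..t}|stieltjes (\<lambda>t. L t $ j). R u (left_lim L u) (left_lim W u) $ k $ j)
       + L t $ k" ..
    have L0: "L 0 $ j = 0" for j using L_regulator[of j] by (simp add: regulator_def)
    have "(LINT u:{0<..t}|stieltjes (\<lambda>t. L t $ j). R u (left_lim L u) (left_lim W u) $ k $ j) = C $ k $ j * L t $ j"
      if "0 \<le> t" for t j
    proof -
      have "(LINT u:{0<..t}|stieltjes (\<lambda>t. L t $ j). R u (left_lim L u) (left_lim W u) $ k $ j)
          = (LINT u:{0<..t}|stieltjes (\<lambda>t. L t $ j). C $ k $ j)"
        by (rule set_lebesgue_integral_cong) (simp_all add: const left_lims_nonneg)
      also have "\<dots> = C $ k $ j * L t $ j"
        using measure_stieltjes_Ioc[OF L_regulator order_refl that] emeasure_stieltjes_Ioc[OF L_regulator order_refl that]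
        by (simp add: set_lebesgue_integral_def L0)
      finally show ?thesis .
    qed
    then have "\<forall>t\<ge>0. W t $ k = \<kappa> + Y t $ k + ?I t k + (C *v L t) $ k"
      using \<kappa> unit_lower_triangular_mult_nth[OF diag upper, where i = k] by simp
    then show ?thesis ..
  qed
  then have "\<forall>k. \<exists>\<kappa>. \<forall>t\<ge>0. W t $ k = \<kappa> + Y t $ k + ?I t k + (C *v L t) $ k" by (rule allI)
  from choice[OF this] obtain \<kappa> where \<kappa>: "\<forall>k. \<forall>t\<ge>0. W t $ k = \<kappa> k + Y t $ k + ?I t k + (C *v L t) $ k" ..
  show ?thesis
  proof (rule unbounded_of_liminf_cond[OF lim, folded N_def])
    fix t :: real assume t: "0 \<le> t"
    define drift where "drift = (\<chi> k. ?I t k)"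
    have "W t = (\<chi> k. \<kappa> k) + Y t + drift + C *v L t"
      using \<kappa> t by (simp add: vec_eq_iff drift_def)
    then have "N *v W t = N *v (\<chi> k. \<kappa> k) + N *v Y t + N *v drift + L t"
      using NC by (simp add: matrix_vector_right_distrib matrix_vector_mul_assoc)
    moreover have "0 \<le> (N *v W t) $ i" by (rule N_nonneg) (rule W_nonneg[OF t])
    moreover have "(N *v drift) $ i \<le> (LBINT s:{0..t}. sup_drift (\<lambda>s l w. N *v b s l w) i s)"
    proof -
      have "(N *v drift) $ i = (\<Sum>k\<in>UNIV. N $ i $ k * ?I t k)"
        by (simp add: matrix_vector_mult_def drift_def)
      also have "\<dots> = (\<Sum>k\<in>UNIV. LBINT u:{0..t}. N $ i $ k * b u (left_lim L u) (left_lim W u) $ k)"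
        by simp
      also have "\<dots> = (LBINT u:{0..t}. \<Sum>k\<in>UNIV. N $ i $ k * b u (left_lim L u) (left_lim W u) $ k)"
      proof -
        have "integrable lborel (\<lambda>u. indicator {0..t} u *\<^sub>R (N $ i $ k * b u (left_lim L u) (left_lim W u) $ k))" for k
          unfolding set_integrable_def[symmetric]
          by (rule set_integrable_mult_right, rule integrable_path_lborel[where t = t, OF admissible_b]) simp_all
        then show ?thesis
          unfolding set_lebesgue_integral_def scaleR_sum_right by (rule Bochner_Integration.integral_sum[symmetric])
      qed
      also have "\<dots> = (LBINT u:{0..t}. (N *v b u (left_lim L u) (left_lim W u)) $ i)"
        by (simp add: matrix_vector_mult_def)
      also have "\<dots> \<le> (LBINT s:{0..t}. sup_drift (\<lambda>s l w. N *v b s l w) i s)"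
        unfolding sup_drift_def
      proof (rule coeff_path_integral_le_sup[OF admissible_coeff_mult_matrix[OF admissible_b] L_cadlag W_cadlag])
        show "(N *v b t l w) $ i = (N *v b t 0 w) $ i" if "0 \<le> t" "0 \<le> l" "0 \<le> w" for t l w
          using indep_l(1)[OF that(1,2) order_refl that(3)] by simp
      qed (simp_all add: L_nonneg W_nonneg)
      finally show ?thesis .
    qed
    ultimately show "0 \<le> ((N *v (\<chi> k. \<kappa> k)) $ i + (N *v a) $ i)
        + ((N *v X t) $ i + (LBINT s:{0..t}. sup_drift (\<lambda>s l w. N *v b s l w) i s)) + L t $ i"
      by (simp add: shift matrix_vector_right_distrib)
  qed
qed

section \<open>Coupling of translated solutions\<close>

theorem theorem3p6:
  fixes b :: "real \<Rightarrow> real ^ 'n::{finite,linorder} \<Rightarrow> real ^ 'n::{finite,linorder} \<Rightarrow> real ^ 'n::{finite,linorder}"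
    and P R :: "real \<Rightarrow> real ^ 'n::{finite,linorder} \<Rightarrow> real ^ 'n::{finite,linorder} \<Rightarrow>
                  real ^ 'n::{finite,linorder} ^ 'n::{finite,linorder}"
    and X :: "real \<Rightarrow> real ^ 'n::{finite,linorder}"
  assumes "R = reflection P"
    and "cond_A1 b P" and "cond_A2 P" and "cond_A3 b R" and "cond_B1 b R" and "cond_B2 b R"
    and "cadlag X" and "X 0 \<ge> 0"
  shows
    "((\<forall>i. liminf_cond X b i) \<longrightarrow>
       (\<forall>a\<ge>0. \<forall>Wa La W0 L0.
          skorohod_solution b R (\<lambda>t. a + X t) Wa La \<longrightarrow> skorohod_solution b R X W0 L0 \<longrightarrow>
          (\<exists>T\<ge>0. \<forall>t\<ge>T. Wa t = W0 t) \<and> ((\<lambda>t. Wa t - W0 t) \<longlongrightarrow> 0) at_top))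
     \<and>
     (\<forall>C. (\<forall>t\<ge>0. \<forall>l\<ge>0. \<forall>w\<ge>0. R t l w = C) \<longrightarrow>
       (\<forall>i. liminf_cond X b i \<or>
            liminf_cond (\<lambda>t. matrix_inv C *v X t) (\<lambda>s l w. matrix_inv C *v b s l w) i) \<longrightarrow>
       (\<forall>a\<ge>0. \<forall>Wa La W0 L0.
          skorohod_solution b R (\<lambda>t. a + X t) Wa La \<longrightarrow> skorohod_solution b R X W0 L0 \<longrightarrow>
          (\<exists>T\<ge>0. \<forall>t\<ge>T. Wa t = W0 t) \<and> ((\<lambda>t. Wa t - W0 t) \<longlongrightarrow> 0) at_top))"
proof -
  have feed: "feedforward b P R"
    using assms by (intro feedforward.intro)
  have merge: "(\<exists>T\<ge>0. \<forall>t\<ge>T. Wa t = W0 t) \<and> ((\<lambda>t. Wa t - W0 t) \<longlongrightarrow> 0) at_top"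
    if sol: "skorohod_solution b R (\<lambda>t. a + X t) Wa La" "skorohod_solution b R X W0 L0"
      and unbounded: "\<And>Y W L c i. feedforward_solution b P R Y W L \<Longrightarrow> (\<And>t. Y t = c + X t) \<Longrightarrow>
                        \<forall>M. \<exists>t\<ge>0. M < L t $ i"
    for a Wa La W0 L0
  proof -
    have "feedforward_solution b P R (\<lambda>t. a + X t) Wa La"
      using feed sol(1) by (intro feedforward_solution.intro feedforward_solution_axioms.intro)
    moreover have "feedforward_solution b P R X W0 L0"
      using feed sol(2) by (intro feedforward_solution.intro feedforward_solution_axioms.intro)
    ultimately interpret feedforward_pair b P R "\<lambda>t. a + X t" Wa La X W0 L0
      by (intro feedforward_pair.intro feedforward_pair_axioms.intro) simp_all
    have "\<exists>T\<ge>0. \<forall>t\<ge>T. Wa t = W0 t"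
    proof (rule eventually_equal)
      show "\<forall>M. \<exists>t\<ge>0. M < La t $ i" for i
        by (rule unbounded[OF fst.feedforward_solution_axioms refl])
      show "\<forall>M. \<exists>t\<ge>0. M < L0 t $ i" for i
        by (rule unbounded[OF snd.feedforward_solution_axioms, of 0]) simp
    qed
    then obtain T where T: "0 \<le> T" "\<forall>t\<ge>T. Wa t = W0 t" by (elim exE conjE)
    have "eventually (\<lambda>t. Wa t - W0 t = 0) at_top"
      using T by (intro eventually_mono[OF eventually_ge_at_top[of T]]) simp
    with T show ?thesis by (blast intro: tendsto_eventually)
  qed
  show ?thesis
  proof (intro conjI impI allI)
    fix a Wa La W0 L0
    assume lim: "\<forall>i. liminf_cond X b i"
      and sol: "skorohod_solution b R (\<lambda>t. a + X t) Wa La" "skorohod_solution b R X W0 L0"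
    have "(\<exists>T\<ge>0. \<forall>t\<ge>T. Wa t = W0 t) \<and> ((\<lambda>t. Wa t - W0 t) \<longlongrightarrow> 0) at_top"
      by (rule merge[OF sol]) (rule feedforward_solution.unbounded_regulator[OF _ lim[rule_format]])
    then show "\<exists>T\<ge>0. \<forall>t\<ge>T. Wa t = W0 t" "((\<lambda>t. Wa t - W0 t) \<longlongrightarrow> 0) at_top" by simp_all
  next
    fix C a Wa La W0 L0
    assume const: "\<forall>t\<ge>0. \<forall>l\<ge>0. \<forall>w\<ge>0. R t l w = C"
      and lim: "\<forall>i. liminf_cond X b i \<or>
            liminf_cond (\<lambda>t. matrix_inv C *v X t) (\<lambda>s l w. matrix_inv C *v b s l w) i"
      and sol: "skorohod_solution b R (\<lambda>t. a + X t) Wa La" "skorohod_solution b R X W0 L0"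
    have "(\<exists>T\<ge>0. \<forall>t\<ge>T. Wa t = W0 t) \<and> ((\<lambda>t. Wa t - W0 t) \<longlongrightarrow> 0) at_top"
    proof (rule merge[OF sol])
      fix Y W L c i
      assume S: "feedforward_solution b P R Y W L" and Y: "\<And>t. Y t = c + X t"
      from lim[rule_format, of i] show "\<forall>M. \<exists>t\<ge>0. M < L t $ i"
        using feedforward_solution.unbounded_regulator[OF S _ Y]
          feedforward_solution.unbounded_regulator_constant_reflection[OF S const[rule_format] _ Y]
        by (elim disjE)
    qed
    then show "\<exists>T\<ge>0. \<forall>t\<ge>T. Wa t = W0 t" "((\<lambda>t. Wa t - W0 t) \<longlongrightarrow> 0) at_top" by simp_all
  qed
qed

end
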